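(* Let $\mathcal{E}$ be a finite biordered set, and let $\mathbf{x}=(i_1,a_1,\lambda_1)(i_2,a_2,\lambda_2)\dots(i_m,a_m,\lambda_m)\in\mathsf{IG}(\mathcal{E})$ be of $\mathscr{D}$-fingerprint $(D_1,\dots,D_m)$. Furthermore, let $\mathbf{y}\in\mathsf{IG}(\mathcal{E})$. (1) $\mathbf{x}\;\mathscr{R}\;\mathbf{y}$ if and only if $\mathbf{y}=(i_1,a_1,\lambda_1)\dots(i_{m-1},a_{m-1},\lambda_{m-1})(i_m,b,\mu)$ for some $b\in G_m$ and $\mu\in\Lambda_m$. (2) $\mathbf{x}\;\mathscr{L}\;\mathbf{y}$ if and only if $\mathbf{y}=(j,c,\lambda_1)(i_2,a_2,\lambda_2)\dots(i_m,a_m,\lambda_m)$ for some $c\in G_1$ and $j\in I_1$. (3) $\mathbf{x}\;\mathscr{H}\;\mathbf{y}$ if and only if there exist $b\in G_m$, $c\in G_1$, $\mu\in\Lambda_m$ and $j\in I_1$ such that $$\mathbf{y}=(i_1,a_1,\lambda_1)\dots(i_{m-1},a_{m-1},\lambda_{m-1})(i_m,b,\mu)=(j,c,\lambda_1)(i_2,a_2,\lambda_2)\dots(i_m,a_m,\lambda_m)$$ holds in $\mathsf{IG}(\mathcal{E})$. (4) $\mathbf{x}\;\mathscr{D}\;\mathbf{y}$ if and only if there exist $b\in G_m$, $c\in G_1$, $\mu\in\Lambda_m$ and $j\in I_1$ such that $$\mathbf{y}=(j,c,\lambda_1)(i_2,a_2,\lambda_2)\dots(i_{m-1},a_{m-1},\lambda_{m-1})(i_m,b,\mu)$$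 holds in $\mathsf{IG}(\mathcal{E})$. (5) $\mathscr{D}=\mathscr{J}$ holds in $\mathsf{IG}(\mathcal{E})$.
   Context: Biordered sets and $\mathsf{IG}(\mathcal{E})$. For a semigroup $S$ with set of idempotents $E(S)$, $\mathcal{E}_S$ is the partial algebra on $E(S)$ retaining the product $ef$ exactly when $\{ef,fe\}\cap\{e,f\}\neq\varnothing$ (then both $ef,fe$ are idempotents, and $\{e,f\}$ is called a basic pair). A biordered set is a partial algebra $\mathcal{E}=(E,\cdot)$ isomorphic to some $\mathcal{E}_S$. The free idempotent generated semigroup is $\mathsf{IG}(\mathcal{E})=\langle \overline{E}\mid \overline{e}\,\overline{f}=\overline{e\cdot f}\text{ whenever }\{e,f\}\text{ is a basic pair in }\mathcal{E}\rangle$, $\overline E=\{\overline e:e\in E\}$. For a word $w=e_1\dots e_n\in E^+$ put $\overline{w}=\overline{e_1}\dots\overline{e_n}\in\mathsf{IG}(\mathcal{E})$. Triples. For finite $\mathcal{E}$, every regular $\mathscr{D}$-class $D$ of $\mathsf{IG}(\mathcal{E})$ is a $\mathscr{J}$-class with completely $0$-simple principal factor; for each $D$ fix an identification of this principal factor with a Rees matrix semigroup $\mathcal{M}^0[G;I,\Lambda;P]$, where $G$ is (isomorphic to) the maximal subgroup of $D$, and $I,\Lambda$ are finite sets indexing the $\mathscr{R}$- and $\mathscr{L}$-classes of $D$. Elements of $D$ are thus written as triples $(i,g,\lambda)$, $i\in I$, $g\in G$, $\lambda\in\Lambda$. For $D_k$ the data are denoted $G_k,I_k,\Lambda_k$.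 Juxtaposed triples are multiplied in $\mathsf{IG}(\mathcal{E})$. Fingerprints. An r-factorisation of $w\in E^+$ is a factorisation $w=w_1\dots w_m$ into nonempty words with every $\overline{w_i}$ regular in $\mathsf{IG}(\mathcal{E})$; it is minimal if $\overline{w_i\dots w_j}$ is non-regular whenever $i<j$. The sequence $(D_{\overline{w_1}},\dots,D_{\overline{w_m}})$ of $\mathscr{D}$-classes for a minimal r-factorisation depends only on the element $\overline{w}$, and is its $\mathscr{D}$-fingerprint. Writing $\mathbf{x}=(i_1,a_1,\lambda_1)\dots(i_m,a_m,\lambda_m)$ for an element of $\mathscr{D}$-fingerprint $(D_1,\dots,D_m)$ means that there is a word $p_1\dots p_m$ representing $\mathbf{x}$, written as a minimal r-factorisation, with $\overline{p_k}=(i_k,a_k,\lambda_k)\in D_k$ for all $k$. When $m=1$ the products in (1), (2), (4) are read as the single triples $(i_1,b,\mu)$, $(j,c,\lambda_1)$, $(j,b,\mu)$, respectively. *)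

theory Defs
  imports "HOL-Algebra.Group"
begin

section \<open>Semigroups and Green's relations\<close>

text \<open>The records of HOL-Algebra start with monoids; here no identity is available.\<close>

record 'a semigrp = "'a partial_object" +
  smult :: "'a \<Rightarrow> 'a \<Rightarrow> 'a" (infixl "\<cdot>\<index>" 70)

definition is_semigroup :: "'a semigrp \<Rightarrow> bool" where
  "is_semigroup S \<longleftrightarrow>
     (\<forall>x\<in>carrier S. \<forall>y\<in>carrier S. x \<cdot>\<^bsub>S\<^esub> y \<in> carrier S) \<and>
     (\<forall>x\<in>carrier S. \<forall>y\<in>carrier S. \<forall>z\<in>carrier S.
        (x \<cdot>\<^bsub>S\<^esub> y) \<cdot>\<^bsub>S\<^esub> z = x \<cdot>\<^bsub>S\<^esub> (y \<cdot>\<^bsub>S\<^esub> z))"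

definition semigrp_iso :: "'a semigrp \<Rightarrow> 'b semigrp \<Rightarrow> ('a \<Rightarrow> 'b) set" where
  "semigrp_iso S T = {h. bij_betw h (carrier S) (carrier T) \<and>
     (\<forall>x\<in>carrier S. \<forall>y\<in>carrier S. h (x \<cdot>\<^bsub>S\<^esub> y) = h x \<cdot>\<^bsub>T\<^esub> h y)}"

text \<open>Product of a nonempty list of elements; the value on the empty list is irrelevant.\<close>

fun sprod :: "'a semigrp \<Rightarrow> 'a list \<Rightarrow> 'a" where
  "sprod S [] = undefined"
| "sprod S [x] = x"
| "sprod S (x # y # zs) = x \<cdot>\<^bsub>S\<^esub> sprod S (y # zs)"

definition idempotents :: "'a semigrp \<Rightarrow> 'a set" where
  "idempotents S = {e \<in> carrier S. e \<cdot>\<^bsub>S\<^esub> e = e}"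

definition regular :: "'a semigrp \<Rightarrow> 'a \<Rightarrow> bool" where
  "regular S x \<longleftrightarrow> x \<in> carrier S \<and> (\<exists>y\<in>carrier S. x \<cdot>\<^bsub>S\<^esub> y \<cdot>\<^bsub>S\<^esub> x = x)"

text \<open>The principal ideals \<open>x S\<^sup>1\<close>, \<open>S\<^sup>1 x\<close> and \<open>S\<^sup>1 x S\<^sup>1\<close>.\<close>

definition right_ideal :: "'a semigrp \<Rightarrow> 'a \<Rightarrow> 'a set" where
  "right_ideal S x = {x} \<union> {x \<cdot>\<^bsub>S\<^esub> s | s. s \<in> carrier S}"

definition left_ideal :: "'a semigrp \<Rightarrow> 'a \<Rightarrow> 'a set" where
  "left_ideal S x = {x} \<union> {s \<cdot>\<^bsub>S\<^esub> x | s. s \<in> carrier S}"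

definition two_sided_ideal :: "'a semigrp \<Rightarrow> 'a \<Rightarrow> 'a set" where
  "two_sided_ideal S x = {x} \<union> {x \<cdot>\<^bsub>S\<^esub> t | t. t \<in> carrier S} \<union> {s \<cdot>\<^bsub>S\<^esub> x | s. s \<in> carrier S}
     \<union> {s \<cdot>\<^bsub>S\<^esub> x \<cdot>\<^bsub>S\<^esub> t | s t. s \<in> carrier S \<and> t \<in> carrier S}"

definition green_R :: "'a semigrp \<Rightarrow> 'a rel" where
  "green_R S = {(x, y) \<in> carrier S \<times> carrier S. right_ideal S x = right_ideal S y}"

definition green_L :: "'a semigrp \<Rightarrow> 'a rel" where
  "green_L S = {(x, y) \<in> carrier S \<times> carrier S. left_ideal S x = left_ideal S y}"

definition green_H :: "'a semigrp \<Rightarrow> 'a rel" where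
  "green_H S = green_R S \<inter> green_L S"

definition green_D :: "'a semigrp \<Rightarrow> 'a rel" where
  "green_D S = green_R S O green_L S"

definition green_J :: "'a semigrp \<Rightarrow> 'a rel" where
  "green_J S = {(x, y) \<in> carrier S \<times> carrier S. two_sided_ideal S x = two_sided_ideal S y}"

definition D_class :: "'a semigrp \<Rightarrow> 'a \<Rightarrow> 'a set" where
  "D_class S x = green_D S `` {x}"

definition regular_D_classes :: "'a semigrp \<Rightarrow> 'a set set" where
  "regular_D_classes S = {D_class S x | x. regular S x}"


section \<open>Biordered sets\<close>

record 'a partial_algebra = "'a partial_object" +
  pprod :: "'a \<Rightarrow> 'a \<Rightarrow> 'a option"

definition partial_algebra_iso ::
    "'a partial_algebra \<Rightarrow> 'b partial_algebra \<Rightarrow> ('a \<Rightarrow> 'b) set" where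
  "partial_algebra_iso A B = {h. bij_betw h (carrier A) (carrier B) \<and>
     (\<forall>e\<in>carrier A. \<forall>f\<in>carrier A. pprod B (h e) (h f) = map_option h (pprod A e f))}"

definition idempotent_algebra :: "'a semigrp \<Rightarrow> 'a partial_algebra" where
  "idempotent_algebra S =
     \<lparr>carrier = idempotents S,
      pprod = (\<lambda>e f. if {e \<cdot>\<^bsub>S\<^esub> f, f \<cdot>\<^bsub>S\<^esub> e} \<inter> {e, f} \<noteq> {} then Some (e \<cdot>\<^bsub>S\<^esub> f) else None)\<rparr>"

text \<open>
  HOL cannot quantify over the type in which the semigroup \<open>S\<close> lives, so this type is
  an argument; in a theorem it is a type variable, i.e. every type is allowed.
  The closure condition says that \<open>E\<close> is a partial algebra on its carrier.
\<close>

definition biordered_set :: "'s itself \<Rightarrow> 'e partial_algebra \<Rightarrow> bool" where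
  "biordered_set (TYPE('s)) E \<longleftrightarrow>
     (\<forall>e\<in>carrier E. \<forall>f\<in>carrier E. \<forall>g. pprod E e f = Some g \<longrightarrow> g \<in> carrier E) \<and>
     (\<exists>S :: 's semigrp. is_semigroup S \<and> partial_algebra_iso E (idempotent_algebra S) \<noteq> {})"

definition basic_pair :: "'e partial_algebra \<Rightarrow> 'e \<Rightarrow> 'e \<Rightarrow> bool" where
  "basic_pair E e f \<longleftrightarrow> e \<in> carrier E \<and> f \<in> carrier E \<and>
     (\<exists>g h. pprod E e f = Some g \<and> pprod E f e = Some h \<and> {g, h} \<inter> {e, f} \<noteq> {})"


section \<open>Semigroup presentations and the free idempotent generated semigroup\<close>

definition nonempty_words :: "'a set \<Rightarrow> 'a list set" where
  "nonempty_words A = {w. w \<noteq> [] \<and> set w \<subseteq> A}"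

inductive_set pres_cong :: "'a set \<Rightarrow> ('a list \<times> 'a list) set \<Rightarrow> ('a list \<times> 'a list) set"
  for A :: "'a set" and R :: "('a list \<times> 'a list) set" where
  rel: "\<lbrakk>(u, v) \<in> R; u \<in> nonempty_words A; v \<in> nonempty_words A\<rbrakk> \<Longrightarrow> (u, v) \<in> pres_cong A R"
| refl: "u \<in> nonempty_words A \<Longrightarrow> (u, u) \<in> pres_cong A R"
| sym: "(u, v) \<in> pres_cong A R \<Longrightarrow> (v, u) \<in> pres_cong A R"
| trans: "\<lbrakk>(u, v) \<in> pres_cong A R; (v, w) \<in> pres_cong A R\<rbrakk> \<Longrightarrow> (u, w) \<in> pres_cong A R"
| append: "\<lbrakk>(u, v) \<in> pres_cong A R; (u', v') \<in> pres_cong A R\<rbrakk> \<Longrightarrow> (u @ u', v @ v') \<in> pres_cong A R"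

definition presented_semigroup :: "'a set \<Rightarrow> ('a list \<times> 'a list) set \<Rightarrow> 'a list set semigrp" where
  "presented_semigroup A R =
     \<lparr>carrier = nonempty_words A // pres_cong A R,
      smult = (\<lambda>X Y. \<Union>u\<in>X. \<Union>v\<in>Y. pres_cong A R `` {u @ v})\<rparr>"

definition IG_relations :: "'e partial_algebra \<Rightarrow> ('e list \<times> 'e list) set" where
  "IG_relations E = {([e, f], [g]) | e f g. basic_pair E e f \<and> pprod E e f = Some g}"

definition IG :: "'e partial_algebra \<Rightarrow> 'e list set semigrp" where
  "IG E = presented_semigroup (carrier E) (IG_relations E)"

text \<open>\<open>bar E w\<close> is the element of \<open>IG E\<close> represented by the word \<open>w\<close>.\<close>

definition bar :: "'e partial_algebra \<Rightarrow> 'e list \<Rightarrow> 'e list set" where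
  "bar E w = pres_cong (carrier E) (IG_relations E) `` {w}"


section \<open>Rees matrix semigroups and principal factors\<close>

text \<open>In all semigroups with zero below, \<open>None\<close> is the zero.\<close>

record ('g, 'i, 'l) rees_data =
  grp :: "'g monoid"
  rows :: "'i set"
  cols :: "'l set"
  sandwich :: "'l \<Rightarrow> 'i \<Rightarrow> 'g option"

definition valid_rees_data :: "('g, 'i, 'l) rees_data \<Rightarrow> bool" where
  "valid_rees_data M \<longleftrightarrow> group (grp M) \<and>
     finite (rows M) \<and> rows M \<noteq> {} \<and> finite (cols M) \<and> cols M \<noteq> {} \<and>
     (\<forall>l\<in>cols M. \<forall>i\<in>rows M. sandwich M l i \<in> insert None (Some ` carrier (grp M))) \<and>
     (\<forall>l\<in>cols M. \<exists>i\<in>rows M. sandwich M l i \<noteq> None) \<and>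
     (\<forall>i\<in>rows M. \<exists>l\<in>cols M. sandwich M l i \<noteq> None)"

definition triples :: "('g, 'i, 'l) rees_data \<Rightarrow> ('i \<times> 'g \<times> 'l) set" where
  "triples M = rows M \<times> carrier (grp M) \<times> cols M"

fun rees_mult :: "('g, 'i, 'l) rees_data \<Rightarrow>
    ('i \<times> 'g \<times> 'l) option \<Rightarrow> ('i \<times> 'g \<times> 'l) option \<Rightarrow> ('i \<times> 'g \<times> 'l) option" where
  "rees_mult M (Some (i, g, l)) (Some (j, h, k)) =
     (case sandwich M l j of
        None \<Rightarrow> None
      | Some p \<Rightarrow> Some (i, g \<otimes>\<^bsub>grp M\<^esub> p \<otimes>\<^bsub>grp M\<^esub> h, k))"
| "rees_mult M _ _ = None"

definition rees_semigroup :: "('g, 'i, 'l) rees_data \<Rightarrow> ('i \<times> 'g \<times> 'l) option semigrp" where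
  "rees_semigroup M = \<lparr>carrier = insert None (Some ` triples M), smult = rees_mult M\<rparr>"

text \<open>
  The principal factor of a \<open>\<J>\<close>-class \<open>J\<close>. A zero is adjoined also when \<open>J\<close> is the
  minimal ideal, so that the Rees matrix semigroups have the form \<open>\<M>\<^sup>0[G; I, \<Lambda>; P]\<close> throughout.
\<close>

fun factor_mult :: "'a semigrp \<Rightarrow> 'a set \<Rightarrow> 'a option \<Rightarrow> 'a option \<Rightarrow> 'a option" where
  "factor_mult S J (Some x) (Some y) = (if x \<cdot>\<^bsub>S\<^esub> y \<in> J then Some (x \<cdot>\<^bsub>S\<^esub> y) else None)"
| "factor_mult S J _ _ = None"

definition principal_factor :: "'a semigrp \<Rightarrow> 'a set \<Rightarrow> 'a option semigrp" where
  "principal_factor S J = \<lparr>carrier = insert None (Some ` J), smult = factor_mult S J\<rparr>"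

text \<open>
  \<open>t\<close> sends a triple to the element of \<open>D\<close> that it names. An isomorphism preserves the zero,
  hence it has the form \<open>map_option t\<close>.
\<close>

definition rees_identification ::
    "'a semigrp \<Rightarrow> 'a set \<Rightarrow> ('g, 'i, 'l) rees_data \<Rightarrow> ('i \<times> 'g \<times> 'l \<Rightarrow> 'a) \<Rightarrow> bool" where
  "rees_identification S D M t \<longleftrightarrow> valid_rees_data M \<and>
     map_option t \<in> semigrp_iso (rees_semigroup M) (principal_factor S D)"


section \<open>Fingerprints\<close>

definition r_factorisation :: "'e partial_algebra \<Rightarrow> 'e list list \<Rightarrow> bool" where
  "r_factorisation E ws \<longleftrightarrow> ws \<noteq> [] \<and>
     (\<forall>w\<in>set ws. w \<in> nonempty_words (carrier E) \<and> regular (IG E) (bar E w))"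

definition minimal_r_factorisation :: "'e partial_algebra \<Rightarrow> 'e list list \<Rightarrow> bool" where
  "minimal_r_factorisation E ws \<longleftrightarrow> r_factorisation E ws \<and>
     (\<forall>i j. i < j \<and> j < length ws \<longrightarrow>
        \<not> regular (IG E) (bar E (concat (map (\<lambda>k. ws ! k) [i..<Suc j]))))"

definition has_fingerprint :: "'e partial_algebra \<Rightarrow> 'e list set \<Rightarrow> 'e list set set list \<Rightarrow> bool" where
  "has_fingerprint E x Ds \<longleftrightarrow>
     (\<exists>ws. minimal_r_factorisation E ws \<and> bar E (concat ws) = x \<and>
        map (\<lambda>w. D_class (IG E) (bar E w)) ws = Ds)"

text \<open>
  The convention for writing \<open>x = (i\<^sub>1, a\<^sub>1, \<lambda>\<^sub>1) \<dots> (i\<^sub>m, a\<^sub>m, \<lambda>\<^sub>m)\<close> for an element \<open>x\<close> of fingerprint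
  \<open>(D\<^sub>1, \<dots>, D\<^sub>m)\<close>. The indices run over \<open>1, \<dots>, m\<close>, whereas the list \<open>p\<close> of words is indexed from 0.
\<close>

definition triple_form ::
    "'e partial_algebra \<Rightarrow> ('e list set set \<Rightarrow> ('g, 'i, 'l) rees_data) \<Rightarrow>
     ('e list set set \<Rightarrow> 'i \<times> 'g \<times> 'l \<Rightarrow> 'e list set) \<Rightarrow>
     nat \<Rightarrow> (nat \<Rightarrow> 'e list set set) \<Rightarrow> (nat \<Rightarrow> 'i \<times> 'g \<times> 'l) \<Rightarrow> 'e list set \<Rightarrow> bool" where
  "triple_form E M t m D z x \<longleftrightarrow>
     (\<exists>p. length p = m \<and> minimal_r_factorisation E p \<and> bar E (concat p) = x \<and>
        (\<forall>k\<in>{1..m}. z k \<in> triples (M (D k)) \<and>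
           bar E (p ! (k - 1)) = t (D k) (z k) \<and> bar E (p ! (k - 1)) \<in> D k))"

end

(*
  Call a product of two regular factors mergeable if it is regular. If xy is regular for regular x, y, then
  xy R x or xy L y: this is read off a word by following a letter ("seed") that generates the D-class of
  the word through the defining relations. Hence merging adjacent factors is confluent up to slides
  (xy, z) ~ (x, yz) with xy R x and yz L z, and the J-classes of the factors in an irreducible factorisation
  depend only on the element. Multiplying an irreducible factorisation x = w_1 ... w_m by v on the right
  either keeps w_m in its R-class or replaces a final segment by a single factor strictly below all of it
  in the J-order (or adds factors). The latter strictly increases the multiset of J-classes in the multiset
  extension of the reversed J-order, and so does its dual on the left; so neither can be undone inside
  the J-class of x. This gives w_m v R w_m whenever xv J x, from which all five claims follow.
*)

theory Submission
  imports Defs "HOL-Library.Multiset"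
begin

section \<open>Green's relations\<close>

text \<open>The obstacle is stability: that x s J x forces x s R x. IG(E) may be infinite, so this
  cannot be had by counting. What is given is a Rees matrix structure on each regular D-class; it
  yields stability for regular elements, and the comparison of multisets carries it over to all
  elements. That comparison rests on transitivity and irreflexivity of the multiset order alone, so
  it suits a J-order about whose chains nothing is known.

  Confluence holds only modulo slides because xy and yz can be regular while xyz is not; then the
  two ways of merging x, y, z have no common continuation at that place. A slide may change
  R-classes and L-classes of factors, but never their J-classes, which is why J-classes are
  recorded.

  Factors are first taken to be the elements D-related to a generator: such an element comes with
  the letter from which a seed is found. That these are all the regular elements is deduced from
  stability.\<close>

locale sgrp =
  fixes S :: "'a semigrp" (structure)
  assumes semigroup: "is_semigroup S"
begin

lemma closed [simp, intro]: "x \<in> carrier S \<Longrightarrow> y \<in> carrier S \<Longrightarrow> x \<cdot> y \<in> carrier S"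
  using semigroup by (simp add: is_semigroup_def)

lemma assoc:
  "x \<in> carrier S \<Longrightarrow> y \<in> carrier S \<Longrightarrow> z \<in> carrier S \<Longrightarrow> x \<cdot> y \<cdot> z = x \<cdot> (y \<cdot> z)"
  using semigroup by (simp add: is_semigroup_def)

lemma right_idealI [simp, intro]: "x \<in> right_ideal S x" "s \<in> carrier S \<Longrightarrow> x \<cdot> s \<in> right_ideal S x"
  by (auto simp: right_ideal_def)

lemma left_idealI [simp, intro]: "x \<in> left_ideal S x" "s \<in> carrier S \<Longrightarrow> s \<cdot> x \<in> left_ideal S x"
  by (auto simp: left_ideal_def)

lemma right_idealE:
  assumes "y \<in> right_ideal S x"
  obtains "y = x" | s where "s \<in> carrier S" "y = x \<cdot> s"
  using assms by (auto simp: right_ideal_def)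

lemma left_idealE:
  assumes "y \<in> left_ideal S x"
  obtains "y = x" | s where "s \<in> carrier S" "y = s \<cdot> x"
  using assms by (auto simp: left_ideal_def)

lemma right_ideal_mono:
  assumes "x \<in> carrier S" "y \<in> right_ideal S x"
  shows "right_ideal S y \<subseteq> right_ideal S x"
proof
  fix z assume "z \<in> right_ideal S y"
  then show "z \<in> right_ideal S x"
    using assms by (auto elim!: right_idealE simp: assoc)
qed

lemma left_ideal_mono:
  assumes "x \<in> carrier S" "y \<in> left_ideal S x"
  shows "left_ideal S y \<subseteq> left_ideal S x"
proof
  fix z assume "z \<in> left_ideal S y"
  then show "z \<in> left_ideal S x"
    using assms by (auto elim!: left_idealE simp: assoc [symmetric])
qed

lemma two_sided_ideal_iff:
  "y \<in> two_sided_ideal S x \<longleftrightarrow> (\<exists>z\<in>left_ideal S x. y \<in> right_ideal S z)"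
  by (auto simp: two_sided_ideal_def right_ideal_def left_ideal_def)

lemma two_sided_ideal_iff':
  assumes "x \<in> carrier S"
  shows "y \<in> two_sided_ideal S x \<longleftrightarrow> (\<exists>z\<in>right_ideal S x. y \<in> left_ideal S z)"
proof -
  have "(\<exists>s\<in>carrier S. \<exists>t\<in>carrier S. y = s \<cdot> x \<cdot> t) \<longleftrightarrow>
      (\<exists>s\<in>carrier S. \<exists>t\<in>carrier S. y = s \<cdot> (x \<cdot> t))"
    by (intro bex_cong) (simp_all add: assms assoc)
  moreover have "y \<in> two_sided_ideal S x \<longleftrightarrow> y = x \<or> (\<exists>t\<in>carrier S. y = x \<cdot> t) \<or>
      (\<exists>s\<in>carrier S. y = s \<cdot> x) \<or> (\<exists>s\<in>carrier S. \<exists>t\<in>carrier S. y = s \<cdot> x \<cdot> t)"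
    unfolding two_sided_ideal_def by blast
  moreover have "(\<exists>z\<in>right_ideal S x. y \<in> left_ideal S z) \<longleftrightarrow> y = x \<or> (\<exists>t\<in>carrier S. y = x \<cdot> t) \<or>
      (\<exists>s\<in>carrier S. y = s \<cdot> x) \<or> (\<exists>s\<in>carrier S. \<exists>t\<in>carrier S. y = s \<cdot> (x \<cdot> t))"
    unfolding right_ideal_def left_ideal_def by blast
  ultimately show ?thesis
    by presburger
qed

lemma two_sided_idealI:
  assumes "x \<in> carrier S"
  shows "x \<in> two_sided_ideal S x"
    and "s \<in> carrier S \<Longrightarrow> x \<cdot> s \<in> two_sided_ideal S x"
    and "s \<in> carrier S \<Longrightarrow> s \<cdot> x \<in> two_sided_ideal S x"
  using assms by (auto simp: two_sided_ideal_def)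

lemma right_ideal_carrier: "x \<in> carrier S \<Longrightarrow> y \<in> right_ideal S x \<Longrightarrow> y \<in> carrier S"
  by (auto elim!: right_idealE)

lemma left_ideal_carrier: "x \<in> carrier S \<Longrightarrow> y \<in> left_ideal S x \<Longrightarrow> y \<in> carrier S"
  by (auto elim!: left_idealE)

lemma two_sided_ideal_carrier: "x \<in> carrier S \<Longrightarrow> y \<in> two_sided_ideal S x \<Longrightarrow> y \<in> carrier S"
  by (auto simp: two_sided_ideal_def)

lemma two_sided_ideal_mono:
  assumes x: "x \<in> carrier S" and y: "y \<in> two_sided_ideal S x"
  shows "two_sided_ideal S y \<subseteq> two_sided_ideal S x"
proof
  fix z assume "z \<in> two_sided_ideal S y"
  then obtain a where a: "a \<in> right_ideal S y" "z \<in> left_ideal S a"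
    using two_sided_ideal_iff' x y two_sided_ideal_carrier by blast
  obtain b where b: "b \<in> left_ideal S x" "y \<in> right_ideal S b"
    using y two_sided_ideal_iff by blast
  then have "a \<in> right_ideal S b"
    using a x left_ideal_carrier right_ideal_mono by blast
  then have "a \<in> two_sided_ideal S x"
    using b two_sided_ideal_iff by blast
  then obtain c where "c \<in> right_ideal S x" "a \<in> left_ideal S c"
    using two_sided_ideal_iff' x by blast
  then show "z \<in> two_sided_ideal S x"
    using two_sided_ideal_iff' x a(2) left_ideal_mono right_ideal_carrier by blast
qed

section \<open>Green's relations as equivalences and one-sided congruences\<close>

lemma green_R_iff:
  "(x, y) \<in> green_R S \<longleftrightarrow>
     x \<in> carrier S \<and> y \<in> carrier S \<and> x \<in> right_ideal S y \<and> y \<in> right_ideal S x"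
  unfolding green_R_def using right_ideal_mono by blast

lemma green_L_iff:
  "(x, y) \<in> green_L S \<longleftrightarrow>
     x \<in> carrier S \<and> y \<in> carrier S \<and> x \<in> left_ideal S y \<and> y \<in> left_ideal S x"
  unfolding green_L_def using left_ideal_mono by blast

lemma green_R_carrier: "(x, y) \<in> green_R S \<Longrightarrow> x \<in> carrier S \<and> y \<in> carrier S"
  by (simp add: green_R_iff)

lemma green_L_carrier: "(x, y) \<in> green_L S \<Longrightarrow> x \<in> carrier S \<and> y \<in> carrier S"
  by (simp add: green_L_iff)

lemma green_R_refl: "x \<in> carrier S \<Longrightarrow> (x, x) \<in> green_R S"
  by (simp add: green_R_def)

lemma green_L_refl: "x \<in> carrier S \<Longrightarrow> (x, x) \<in> green_L S"
  by (simp add: green_L_def)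

lemma green_R_sym: "(x, y) \<in> green_R S \<Longrightarrow> (y, x) \<in> green_R S"
  by (simp add: green_R_def)

lemma green_L_sym: "(x, y) \<in> green_L S \<Longrightarrow> (y, x) \<in> green_L S"
  by (simp add: green_L_def)

lemma green_R_trans: "(x, y) \<in> green_R S \<Longrightarrow> (y, z) \<in> green_R S \<Longrightarrow> (x, z) \<in> green_R S"
  by (simp add: green_R_def)

lemma green_L_trans: "(x, y) \<in> green_L S \<Longrightarrow> (y, z) \<in> green_L S \<Longrightarrow> (x, z) \<in> green_L S"
  by (simp add: green_L_def)

lemma right_ideal_cong:
  assumes "y \<in> right_ideal S x" "x \<in> carrier S" "z \<in> carrier S"
  shows "z \<cdot> y \<in> right_ideal S (z \<cdot> x)"
  using assms by (auto elim!: right_idealE simp: assoc [symmetric])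

lemma left_ideal_cong:
  assumes "y \<in> left_ideal S x" "x \<in> carrier S" "z \<in> carrier S"
  shows "y \<cdot> z \<in> left_ideal S (x \<cdot> z)"
  using assms by (auto elim!: left_idealE simp: assoc)

lemma green_R_cong:
  "(x, y) \<in> green_R S \<Longrightarrow> z \<in> carrier S \<Longrightarrow> (z \<cdot> x, z \<cdot> y) \<in> green_R S"
  unfolding green_R_iff by (auto intro: right_ideal_cong)

lemma green_L_cong:
  "(x, y) \<in> green_L S \<Longrightarrow> z \<in> carrier S \<Longrightarrow> (x \<cdot> z, y \<cdot> z) \<in> green_L S"
  unfolding green_L_iff by (auto intro: left_ideal_cong)

lemma green_R_between:
  assumes "(x \<cdot> s \<cdot> t, x) \<in> green_R S" "x \<in> carrier S" "s \<in> carrier S" "t \<in> carrier S"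
  shows "(x \<cdot> s, x) \<in> green_R S"
proof -
  have "x \<in> right_ideal S (x \<cdot> s \<cdot> t)" "x \<cdot> s \<cdot> t \<in> right_ideal S (x \<cdot> s)"
    using assms by (auto simp: green_R_iff)
  then show ?thesis
    using assms right_ideal_mono by (auto simp: green_R_iff)
qed

lemma green_L_between:
  assumes "(t \<cdot> (s \<cdot> x), x) \<in> green_L S" "x \<in> carrier S" "s \<in> carrier S" "t \<in> carrier S"
  shows "(s \<cdot> x, x) \<in> green_L S"
proof -
  have "x \<in> left_ideal S (t \<cdot> (s \<cdot> x))" "t \<cdot> (s \<cdot> x) \<in> left_ideal S (s \<cdot> x)"
    using assms by (auto simp: green_L_iff)
  then show ?thesis
    using assms left_ideal_mono by (auto simp: green_L_iff)
qed

lemma green_R_imp_J: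
  assumes "(x, y) \<in> green_R S"
  shows "two_sided_ideal S x = two_sided_ideal S y"
proof -
  have "x \<in> two_sided_ideal S y" "y \<in> two_sided_ideal S x"
    using assms left_idealI(1) two_sided_ideal_iff unfolding green_R_iff by blast+
  then show ?thesis
    using assms two_sided_ideal_mono unfolding green_R_iff by blast
qed

lemma green_L_imp_J:
  assumes "(x, y) \<in> green_L S"
  shows "two_sided_ideal S x = two_sided_ideal S y"
proof -
  have "x \<in> two_sided_ideal S y" "y \<in> two_sided_ideal S x"
    using assms right_idealI(1) two_sided_ideal_iff unfolding green_L_iff by blast+
  then show ?thesis
    using assms two_sided_ideal_mono unfolding green_L_iff by blast
qed

text \<open>With x = y s and z = t y, the element z s = t x completes the square: it is L-related to
  y s = x and R-related to t y = z. Together with the dual this makes D symmetric and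
  transitive.\<close>

lemma green_RL_imp_LR:
  assumes "(x, y) \<in> green_R S" "(y, z) \<in> green_L S"
  shows "\<exists>w. (x, w) \<in> green_L S \<and> (w, z) \<in> green_R S"
proof -
  have C: "x \<in> carrier S" "y \<in> carrier S" "z \<in> carrier S"
    using assms by (auto simp: green_R_iff green_L_iff)
  have "x \<in> right_ideal S y"
    using assms by (simp add: green_R_iff)
  then show ?thesis
  proof (cases rule: right_idealE)
    case 1
    then show ?thesis
      using assms C by (metis green_R_refl)
  next
    case (2 s)
    have L: "(x, z \<cdot> s) \<in> green_L S"
      using green_L_cong [OF assms(2) 2(1)] 2 by simp
    have "z \<in> left_ideal S y"
      using assms by (simp add: green_L_iff)
    then have "(z \<cdot> s, z) \<in> green_R S"
    proof (cases rule: left_idealE)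
      case 1
      then show ?thesis
        using assms 2 by simp
    next
      case t: (2 t)
      show ?thesis
        using green_R_cong [OF assms(1) t(1)] t 2 C by (simp add: assoc)
    qed
    then show ?thesis
      using L by blast
  qed
qed

lemma green_LR_imp_RL:
  assumes "(x, y) \<in> green_L S" "(y, z) \<in> green_R S"
  shows "\<exists>w. (x, w) \<in> green_R S \<and> (w, z) \<in> green_L S"
  using green_RL_imp_LR [of z y x] assms green_R_sym green_L_sym by blast

lemma green_D_iff: "(x, y) \<in> green_D S \<longleftrightarrow> (\<exists>z. (x, z) \<in> green_R S \<and> (z, y) \<in> green_L S)"
  by (auto simp: green_D_def)

lemma green_R_imp_D: "(x, y) \<in> green_R S \<Longrightarrow> (x, y) \<in> green_D S"
  using green_L_refl green_R_carrier green_D_iff by blast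

lemma green_L_imp_D: "(x, y) \<in> green_L S \<Longrightarrow> (x, y) \<in> green_D S"
  using green_R_refl green_L_carrier green_D_iff by blast

lemma green_D_carrier: "(x, y) \<in> green_D S \<Longrightarrow> x \<in> carrier S \<and> y \<in> carrier S"
  using green_D_iff green_R_carrier green_L_carrier by blast

lemma green_D_refl: "x \<in> carrier S \<Longrightarrow> (x, x) \<in> green_D S"
  by (simp add: green_R_imp_D green_R_refl)

lemma green_D_sym: "(x, y) \<in> green_D S \<Longrightarrow> (y, x) \<in> green_D S"
  by (meson green_D_iff green_LR_imp_RL green_L_sym green_R_sym)

lemma green_D_trans: "(x, y) \<in> green_D S \<Longrightarrow> (y, z) \<in> green_D S \<Longrightarrow> (x, z) \<in> green_D S"
  by (meson green_D_iff green_LR_imp_RL green_L_trans green_R_trans)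

lemma green_D_imp_J: "(x, y) \<in> green_D S \<Longrightarrow> two_sided_ideal S x = two_sided_ideal S y"
  by (metis green_D_iff green_R_imp_J green_L_imp_J)

section \<open>Regularity is constant on D-classes\<close>

lemma regular_iff: "regular S x \<longleftrightarrow> x \<in> carrier S \<and> (\<exists>y\<in>carrier S. x \<cdot> (y \<cdot> x) = x)"
  by (auto simp: regular_def assoc)

text \<open>If x x' x = x, then x x' acts as a left identity on the right ideal of x, hence on y;
  substituting x = y s into x x' y = y gives y (s x') y = y.\<close>

lemma regular_R:
  assumes "regular S x" "(x, y) \<in> green_R S"
  shows "regular S y"
proof -
  have C: "x \<in> carrier S" "y \<in> carrier S"
    using assms green_R_carrier by auto
  obtain x' where x': "x' \<in> carrier S" "x \<cdot> (x' \<cdot> x) = x"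
    using assms by (auto simp: regular_iff)
  have e: "x \<cdot> (x' \<cdot> y) = y"
  proof -
    have "y \<in> right_ideal S x"
      using assms by (simp add: green_R_iff)
    then show ?thesis
    proof (cases rule: right_idealE)
      case (2 s)
      have "x \<cdot> (x' \<cdot> (x \<cdot> s)) = x \<cdot> (x' \<cdot> x) \<cdot> s"
        using x'(1) C 2(1) by (simp add: assoc)
      then show ?thesis
        using 2 x' by simp
    qed (use x' in simp)
  qed
  have "x \<in> right_ideal S y"
    using assms by (simp add: green_R_iff)
  then show ?thesis
  proof (cases rule: right_idealE)
    case (2 s)
    then have "y \<cdot> (s \<cdot> x' \<cdot> y) = y"
      using e x' C by (simp add: assoc)
    then show ?thesis
      using C 2 x' by (auto simp: regular_iff)
  qed (use assms in simp)
qed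

lemma regular_L:
  assumes "regular S x" "(x, y) \<in> green_L S"
  shows "regular S y"
proof -
  have C: "x \<in> carrier S" "y \<in> carrier S"
    using assms green_L_carrier by auto
  obtain x' where x': "x' \<in> carrier S" "x \<cdot> (x' \<cdot> x) = x"
    using assms by (auto simp: regular_iff)
  have e: "y \<cdot> (x' \<cdot> x) = y"
  proof -
    have "y \<in> left_ideal S x"
      using assms by (simp add: green_L_iff)
    then show ?thesis
    proof (cases rule: left_idealE)
      case (2 s)
      then show ?thesis
        using x' C by (simp add: assoc)
    qed (use x' in simp)
  qed
  have "x \<in> left_ideal S y"
    using assms by (simp add: green_L_iff)
  then show ?thesis
  proof (cases rule: left_idealE)
    case (2 s)
    then have "y \<cdot> (x' \<cdot> s \<cdot> y) = y"
      using e x' C by (simp add: assoc)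
    then show ?thesis
      using C 2 x' by (auto simp: regular_iff)
  qed (use assms in simp)
qed

lemma regular_D: "regular S x \<Longrightarrow> (x, y) \<in> green_D S \<Longrightarrow> regular S y"
  by (meson green_D_iff regular_R regular_L)

section \<open>Products of nonempty lists\<close>

lemma sprod_Cons: "xs \<noteq> [] \<Longrightarrow> sprod S (x # xs) = x \<cdot> sprod S xs"
  by (cases xs) auto

lemma sprod_closed: "xs \<noteq> [] \<Longrightarrow> set xs \<subseteq> carrier S \<Longrightarrow> sprod S xs \<in> carrier S"
  by (induction xs rule: list_nonempty_induct) (auto simp: sprod_Cons)

lemma sprod_append:
  assumes "xs \<noteq> []" "ys \<noteq> []" "set xs \<subseteq> carrier S" "set ys \<subseteq> carrier S"
  shows "sprod S (xs @ ys) = sprod S xs \<cdot> sprod S ys"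
  using assms(1,3)
proof (induction xs rule: list_nonempty_induct)
  case (single x)
  then show ?case
    using assms by (simp add: sprod_Cons)
next
  case (cons x xs)
  then show ?case
    using assms by (simp add: sprod_Cons assoc sprod_closed)
qed

end


section \<open>The opposite semigroup\<close>

text \<open>Serves left-right duality: \<open>rank_mult_left\<close>,
  \<open>green_L_irreducible_iff\<close>, \<open>green_L_stable\<close> and
  \<open>J_stable_L\<close> are their right-hand counterparts read in the opposite
  semigroup.\<close>

definition opp :: "'a semigrp \<Rightarrow> 'a semigrp" where
  "opp S = \<lparr>carrier = carrier S, smult = (\<lambda>x y. y \<cdot>\<^bsub>S\<^esub> x)\<rparr>"

lemma opp_simps [simp]: "carrier (opp S) = carrier S" "x \<cdot>\<^bsub>opp S\<^esub> y = y \<cdot>\<^bsub>S\<^esub> x"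
  by (simp_all add: opp_def)

lemma right_ideal_opp [simp]: "right_ideal (opp S) x = left_ideal S x"
  by (simp add: right_ideal_def left_ideal_def)

lemma left_ideal_opp [simp]: "left_ideal (opp S) x = right_ideal S x"
  by (simp add: right_ideal_def left_ideal_def)

lemma green_R_opp [simp]: "green_R (opp S) = green_L S"
  by (simp add: green_R_def green_L_def)

lemma green_L_opp [simp]: "green_L (opp S) = green_R S"
  by (simp add: green_R_def green_L_def)

context sgrp
begin

lemma sgrp_opp: "sgrp (opp S)"
  by standard (auto simp: is_semigroup_def assoc)

lemma two_sided_ideal_opp:
  assumes "x \<in> carrier S"
  shows "two_sided_ideal (opp S) x = two_sided_ideal S x"
proof -
  interpret o: sgrp "opp S" by (rule sgrp_opp)
  show ?thesis
    using o.two_sided_ideal_iff two_sided_ideal_iff' [OF assms] by auto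
qed

lemma sprod_opp:
  assumes "xs \<noteq> []" "set xs \<subseteq> carrier S"
  shows "sprod (opp S) (rev xs) = sprod S xs"
  using assms
proof (induction xs rule: list_nonempty_induct)
  case (cons x xs)
  interpret o: sgrp "opp S" by (rule sgrp_opp)
  have "sprod (opp S) (rev xs @ [x]) = x \<cdot> sprod (opp S) (rev xs)"
    using cons by (subst o.sprod_append) auto
  then show ?case
    using cons by (simp add: sprod_Cons)
qed simp

end


section \<open>Merging factors\<close>

text \<open>The properties of factors on which the rewriting depends. Closure under R and L
  recognises products as factors without computing them; \<open>N_split\<close> is the substantial
  condition, and in IG(E) it comes from seeds.\<close>

locale factor_set = sgrp +
  fixes N :: "'a set"
  assumes N_carrier: "N \<subseteq> carrier S"
    and N_R: "x \<in> N \<Longrightarrow> (x, y) \<in> green_R S \<Longrightarrow> y \<in> N"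
    and N_L: "x \<in> N \<Longrightarrow> (x, y) \<in> green_L S \<Longrightarrow> y \<in> N"
    and N_split: "x \<in> N \<Longrightarrow> y \<in> N \<Longrightarrow> x \<cdot> y \<in> N \<Longrightarrow>
      (x \<cdot> y, x) \<in> green_R S \<or> (x \<cdot> y, y) \<in> green_L S"
begin

lemma N_closed [simp, intro]: "x \<in> N \<Longrightarrow> x \<in> carrier S"
  using N_carrier by blast

inductive merge :: "'a list \<Rightarrow> 'a list \<Rightarrow> bool" where
  merge_hd: "x \<in> N \<Longrightarrow> y \<in> N \<Longrightarrow> x \<cdot> y \<in> N \<Longrightarrow> merge (x # y # s) (x \<cdot> y # s)"
| merge_Cons: "merge s t \<Longrightarrow> merge (x # s) (x # t)"

text \<open>An element y is moved from the front of the second factor to the end of the first, or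
  back; admitting both directions makes the relation symmetric. The model is the pair of merges of
  x, y, z into (xy), z and into x, (yz).\<close>

definition slides :: "'a \<Rightarrow> 'a \<Rightarrow> 'a \<Rightarrow> 'a \<Rightarrow> bool" where
  "slides x z x' z' \<longleftrightarrow> x \<in> N \<and> z \<in> N \<and> (x, x') \<in> green_R S \<and> (z, z') \<in> green_L S \<and>
     (\<exists>y\<in>carrier S. x' = x \<cdot> y \<and> z = y \<cdot> z' \<or> x = x' \<cdot> y \<and> z' = y \<cdot> z)"

inductive slide :: "'a list \<Rightarrow> 'a list \<Rightarrow> bool" where
  slide_hd: "slides x z x' z' \<Longrightarrow> slide (x # z # s) (x' # z' # s)"
| slide_Cons: "slide s t \<Longrightarrow> slide (x # s) (x # t)"

lemma merge_ConsE:
  assumes "merge (x # s) t"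
  obtains (hd) y r where "s = y # r" "t = x \<cdot> y # r" "x \<in> N" "y \<in> N" "x \<cdot> y \<in> N"
  | (tl) r where "t = x # r" "merge s r"
  using assms by (cases rule: merge.cases) auto

lemma slide_ConsE:
  assumes "slide (x # s) t"
  obtains (hd) z r x' z' where "s = z # r" "t = x' # z' # r" "slides x z x' z'"
  | (tl) r where "t = x # r" "slide s r"
  using assms by (cases rule: slide.cases) auto

lemma slidesD:
  assumes "slides x z x' z'"
  shows "x \<in> N" "z \<in> N" "x' \<in> N" "z' \<in> N" "(x, x') \<in> green_R S" "(z, z') \<in> green_L S"
    and "x \<cdot> z = x' \<cdot> z'"
proof -
  show *: "x \<in> N" "z \<in> N" "x' \<in> N" "z' \<in> N" "(x, x') \<in> green_R S" "(z, z') \<in> green_L S"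
    using assms N_R N_L unfolding slides_def by blast+
  show "x \<cdot> z = x' \<cdot> z'"
    using assms * unfolding slides_def by (auto simp: assoc)
qed

lemma slides_sym: "slides x z x' z' \<Longrightarrow> slides x' z' x z"
  unfolding slides_def using N_R N_L green_R_sym green_L_sym by blast

text \<open>Merging a neighbour into a sliding factor does not destroy the slide: the same y still
  witnesses it, and R is a left congruence.\<close>

lemma slides_merge_left:
  assumes "slides x z x' z'" "p \<in> N" "p \<cdot> x \<in> N"
  shows "slides (p \<cdot> x) z (p \<cdot> x') z'" "p \<cdot> x' \<in> N"
proof -
  note * = slidesD [OF assms(1)]
  have R: "(p \<cdot> x, p \<cdot> x') \<in> green_R S"
    using * assms green_R_cong by blast
  then show "p \<cdot> x' \<in> N"
    using assms N_R by blast
  obtain y where "y \<in> carrier S" "x' = x \<cdot> y \<and> z = y \<cdot> z' \<or> x = x' \<cdot> y \<and> z' = y \<cdot> z"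
    using assms unfolding slides_def by blast
  then have "\<exists>y\<in>carrier S. p \<cdot> x' = p \<cdot> x \<cdot> y \<and> z = y \<cdot> z' \<or> p \<cdot> x = p \<cdot> x' \<cdot> y \<and> z' = y \<cdot> z"
    using * assms by (intro bexI [of _ y]) (auto simp: assoc)
  then show "slides (p \<cdot> x) z (p \<cdot> x') z'"
    using R * assms unfolding slides_def by blast
qed

lemma slides_merge_right:
  assumes "slides x z x' z'" "q \<in> N" "z \<cdot> q \<in> N"
  shows "slides x (z \<cdot> q) x' (z' \<cdot> q)" "z' \<cdot> q \<in> N"
proof -
  note * = slidesD [OF assms(1)]
  have L: "(z \<cdot> q, z' \<cdot> q) \<in> green_L S"
    using * assms green_L_cong by blast
  then show "z' \<cdot> q \<in> N"
    using assms N_L by blast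
  obtain y where "y \<in> carrier S" "x' = x \<cdot> y \<and> z = y \<cdot> z' \<or> x = x' \<cdot> y \<and> z' = y \<cdot> z"
    using assms unfolding slides_def by blast
  then have "\<exists>y\<in>carrier S. x' = x \<cdot> y \<and> z \<cdot> q = y \<cdot> (z' \<cdot> q) \<or> x = x' \<cdot> y \<and> z' \<cdot> q = y \<cdot> (z \<cdot> q)"
    using * assms by (intro bexI [of _ y]) (auto simp: assoc)
  then show "slides x (z \<cdot> q) x' (z' \<cdot> q)"
    using L * assms unfolding slides_def by blast
qed

lemma slide_sym: "slide s t \<Longrightarrow> slide t s"
  by (induction rule: slide.induct) (auto intro: slide.intros slides_sym)

lemma slide_map_ideal: "slide s t \<Longrightarrow> map (two_sided_ideal S) s = map (two_sided_ideal S) t"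
proof (induction rule: slide.induct)
  case (slide_hd x z x' z' s)
  then show ?case
    using slidesD(5,6) green_R_imp_J green_L_imp_J by simp
qed simp

text \<open>The only critical pair of the rewriting. If xy L y, then xyz L yz, so xyz is a factor;
  dually if yz R y. Otherwise \<open>N_split\<close> leaves xy R x and yz L z, which is a
  slide.\<close>

lemma merge_overlap:
  assumes "x \<in> N" "y \<in> N" "z \<in> N" "x \<cdot> y \<in> N" "y \<cdot> z \<in> N"
  shows "x \<cdot> y \<cdot> z \<in> N \<or> slides (x \<cdot> y) z x (y \<cdot> z)"
proof -
  consider "(x \<cdot> y, y) \<in> green_L S" | "(y \<cdot> z, y) \<in> green_R S"
    | "(x \<cdot> y, x) \<in> green_R S" "(y \<cdot> z, z) \<in> green_L S"
    using assms N_split by blast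
  then show ?thesis
  proof cases
    case 1
    then have "(y \<cdot> z, x \<cdot> y \<cdot> z) \<in> green_L S"
      using assms green_L_cong green_L_sym by blast
    then show ?thesis
      using assms N_L by blast
  next
    case 2
    then have "(x \<cdot> y, x \<cdot> (y \<cdot> z)) \<in> green_R S"
      using assms green_R_cong green_R_sym by blast
    then show ?thesis
      using assms N_R by (simp add: assoc)
  next
    case 3
    then show ?thesis
      using assms green_L_sym unfolding slides_def by blast
  qed
qed

lemma merge_merge:
  assumes "merge s t1" "merge s t2"
  shows "t1 = t2 \<or> (\<exists>t. merge t1 t \<and> merge t2 t) \<or> slide t1 t2"
  using assms
proof (induction arbitrary: t2 rule: merge.induct)
  case (merge_hd x y s)
  from merge_hd.prems show ?case
  proof (cases rule: merge_ConsE)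
    case (tl t)
    note t2 = \<open>t2 = x # t\<close>
    from \<open>merge (y # s) t\<close> show ?thesis
    proof (cases rule: merge_ConsE)
      case (hd z r)
      then show ?thesis
        using merge_overlap [of x y z] merge_hd.hyps t2
          merge.merge_hd [of "x \<cdot> y" z r] merge.merge_hd [of x "y \<cdot> z" r]
          slide_hd [of "x \<cdot> y" z x "y \<cdot> z" r]
        by (auto simp: assoc)
    next
      case (tl r)
      then show ?thesis
        using merge_hd.hyps t2 by (auto intro: merge.intros)
    qed
  qed auto
next
  case (merge_Cons s t x)
  from merge_Cons.prems show ?case
  proof (cases rule: merge_ConsE)
    case (hd y r)
    note * = hd
    from \<open>merge s t\<close> have "merge (y # r) t"
      using hd by simp
    then show ?thesis
    proof (cases rule: merge_ConsE)
      case (hd z r')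
      then show ?thesis
        using merge_overlap [of x y z] * slides_sym [of "x \<cdot> y" z x "y \<cdot> z"]
          merge.merge_hd [of "x \<cdot> y" z r'] merge.merge_hd [of x "y \<cdot> z" r']
          slide_hd [of x "y \<cdot> z" "x \<cdot> y" z r']
        by (auto simp: assoc)
    next
      case (tl r')
      then show ?thesis
        using * by (auto intro: merge.intros)
    qed
  next
    case (tl r)
    then show ?thesis
      using merge_Cons.IH by (auto intro: merge.intros slide.intros)
  qed
qed

text \<open>Three positions matter. Merging the sliding pair itself gives the same product before
  and after the slide; merging one of the two with an outer neighbour leaves a slide; a merge
  elsewhere commutes with the slide.\<close>

lemma slide_merge:
  assumes "slide s s'" "merge s t"
  shows "\<exists>t'. merge s' t' \<and> (t = t' \<or> slide t t')"
  using assms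
proof (induction arbitrary: t rule: slide.induct)
  case (slide_hd x z x' z' s)
  note * = slidesD [OF slide_hd.hyps]
  from slide_hd.prems show ?case
  proof (cases rule: merge_ConsE)
    case (hd y r)
    then have "merge (x' # z' # s) t"
      using * merge_hd [of x' z' s] by simp
    then show ?thesis
      by blast
  next
    case (tl u)
    note t = \<open>t = x # u\<close>
    from \<open>merge (z # s) u\<close> show ?thesis
    proof (cases rule: merge_ConsE)
      case (hd q r)
      then have "slide t (x' # z' \<cdot> q # r)" "merge (x' # z' # s) (x' # z' \<cdot> q # r)"
        using t * slides_merge_right [OF slide_hd.hyps]
        by (auto intro!: slide.slide_hd merge.intros)
      then show ?thesis
        by blast
    next
      case (tl r)
      then have "slide t (x' # z' # r)" "merge (x' # z' # s) (x' # z' # r)"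
        using t slide_hd.hyps by (auto intro: slide.intros merge.intros)
      then show ?thesis
        by blast
    qed
  qed
next
  case (slide_Cons s s' p)
  from slide_Cons.prems show ?case
  proof (cases rule: merge_ConsE)
    case (hd x r)
    note * = hd
    have "slide (x # r) s'"
      using slide_Cons.hyps hd by simp
    then show ?thesis
    proof (cases rule: slide_ConsE)
      case (hd z q x' z')
      note ** = slidesD [OF hd(3)] slides_merge_left [OF hd(3) *(3,5)]
      have "merge (p # s') (p \<cdot> x' # z' # q)" "slide t (p \<cdot> x' # z' # q)"
        using * ** hd by (auto intro!: slide.slide_hd merge.merge_hd)
      then show ?thesis
        by blast
    next
      case (tl r')
      then have "merge (p # s') (p \<cdot> x # r')" "slide t (p \<cdot> x # r')"
        using * by (auto intro: merge.intros slide.intros)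
      then show ?thesis
        by blast
    qed
  next
    case (tl r)
    then show ?thesis
      using slide_Cons.IH by (blast intro: merge.intros slide.intros)
  qed
qed

section \<open>The J-classes of a completely merged list\<close>

lemma merge_length: "merge s t \<Longrightarrow> length s = Suc (length t)"
  by (induction rule: merge.induct) auto

lemma slide_length: "slide s t \<Longrightarrow> length s = length t"
  by (induction rule: slide.induct) auto

text \<open>Follows one arbitrarily chosen sequence of merges to its end; two-sided ideals stand for
  J-classes. That the choices do not matter is \<open>fingerprint_invariant\<close>.\<close>

function fingerprint :: "'a list \<Rightarrow> 'a set list" where
  "fingerprint s = (if \<exists>t. merge s t then fingerprint (SOME t. merge s t)
     else map (two_sided_ideal S) s)"
  by auto
termination
proof (relation "measure length")
  fix s assume "\<exists>t. merge s t"
  then have "merge s (SOME t. merge s t)"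
    by (rule someI_ex)
  then show "(SOME t. merge s t, s) \<in> measure length"
    by (simp add: merge_length)
qed simp

declare fingerprint.simps [simp del]

lemma fingerprint_stuck:
  assumes "\<not> (\<exists>t. merge s t)"
  shows "fingerprint s = map (two_sided_ideal S) s"
  by (rule HOL.trans [OF fingerprint.simps if_not_P]) (rule assms)

text \<open>Newman's argument modulo slides. Merges shorten the list, so the induction hypothesis
  covers all results of a merge, both for merges and for slides. A slide keeps the length; it is
  pushed below a merge by \<open>slide_merge\<close>, unless both lists are stuck, and then the
  ideals agree entry by entry.\<close>

lemma fingerprint_invariant:
  "(\<forall>t. merge s t \<longrightarrow> fingerprint s = fingerprint t) \<and> (\<forall>t. slide s t \<longrightarrow> fingerprint s = fingerprint t)"
proof (induction "length s" arbitrary: s)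
  case 0
  then show ?case
    by (auto elim: merge.cases slide.cases)
next
  case (Suc n)
  have merge: "fingerprint s = fingerprint t" if "length s = Suc n" "merge s t" for s t
  proof -
    define u where "u = (SOME t. merge s t)"
    have u: "merge s u"
      unfolding u_def using that(2) by (rule someI)
    have len: "n = length u" "n = length t"
      using merge_length [OF u] merge_length [OF that(2)] that(1) by auto
    have "fingerprint u = fingerprint t"
      using merge_merge [OF u that(2)] Suc.hyps(1) len by metis
    then show ?thesis
      using that(2) by (subst fingerprint.simps) (auto simp: u_def)
  qed
  have aux: "fingerprint s = fingerprint t" if st: "length s = Suc n" "slide s t" "merge s s'" for s t s'
  proof -
    obtain t' where t': "merge t t'" "s' = t' \<or> slide s' t'"
      using slide_merge [OF st(2,3)] by blast
    have "n = length s'" "length t = Suc n"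
      using merge_length slide_length st by fastforce+
    then have "fingerprint s' = fingerprint t'"
      using Suc.hyps(1) t' by blast
    then show ?thesis
      using merge st t' \<open>length t = Suc n\<close> by metis
  qed
  have slide: "fingerprint s = fingerprint t" if "slide s t" for t
  proof -
    consider s' where "merge s s'" | t' where "merge t t'" | "\<not> (\<exists>s'. merge s s')" "\<not> (\<exists>t'. merge t t')"
      by blast
    then show ?thesis
    proof cases
      case 1
      then show ?thesis
        using aux [OF _ that 1] Suc.hyps(2) by simp
    next
      case 2
      then show ?thesis
        using aux [OF _ slide_sym [OF that] 2] slide_length [OF that] Suc.hyps(2) by simp
    next
      case 3
      then show ?thesis
        using slide_map_ideal [OF that] fingerprint_stuck [of s] fingerprint_stuck [of t] by simp
    qed
  qed
  show ?case
    using merge slide Suc.hyps(2) by simp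
qed

section \<open>Irreducible lists of factors\<close>

definition irreducible :: "'a list \<Rightarrow> bool" where
  "irreducible s \<longleftrightarrow> set s \<subseteq> N \<and> successively (\<lambda>x y. x \<cdot> y \<notin> N) s"

lemma merge_irreducible: "merge s t \<Longrightarrow> \<not> irreducible s"
  unfolding irreducible_def
proof (induction rule: merge.induct)
  case (merge_Cons s t x)
  then show ?case
    by (auto simp: successively_Cons)
qed simp

text \<open>Complements \<open>merge_irreducible\<close>: among lists over \<open>N\<close>, the
  irreducible ones are exactly those to which no merge applies.\<close>

lemma irreducible_cases:
  assumes "set s \<subseteq> N"
  obtains "irreducible s" | t where "merge s t" "set t \<subseteq> N"
  using assms
proof (induction s arbitrary: thesis)
  case Nil
  then show ?case
    by (simp add: irreducible_def)
next
  case (Cons x s)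
  show ?case
  proof (cases "irreducible s")
    case True
    show ?thesis
    proof (cases "s \<noteq> [] \<and> x \<cdot> hd s \<in> N")
      case True
      then obtain y s' where "s = y # s'" "x \<cdot> y \<in> N"
        by (cases s) auto
      then show ?thesis
        using Cons.prems merge_hd [of x y s'] by auto
    next
      case False
      then show ?thesis
        using Cons.prems True by (auto simp: irreducible_def successively_Cons)
    qed
  next
    case False
    then obtain t where "merge s t" "set t \<subseteq> N"
      using Cons by auto
    then have "merge (x # s) (x # t)" "set (x # t) \<subseteq> N"
      using Cons.prems merge_Cons by auto
    then show ?thesis
      using Cons.prems by blast
  qed
qed

lemma merge_Nil: "merge s t \<Longrightarrow> t \<noteq> []"
  by (induction rule: merge.induct) auto

lemma merge_sprod:
  assumes "merge s t" "set s \<subseteq> N"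
  shows "sprod S s = sprod S t"
  using assms
proof (induction rule: merge.induct)
  case (merge_hd x y s)
  then show ?case
    by (cases s) (auto simp: assoc sprod_closed subset_iff)
next
  case (merge_Cons s t x)
  then have "s \<noteq> []" "t \<noteq> []"
    using merge_length [of s t] merge_Nil [of s t] by auto
  then show ?case
    using merge_Cons by (simp add: sprod_Cons)
qed

lemma ex_irreducible:
  assumes "set s \<subseteq> N" "s \<noteq> []"
  shows "\<exists>t. irreducible t \<and> t \<noteq> [] \<and> sprod S t = sprod S s"
  using assms
proof (induction "length s" arbitrary: s)
  case (Suc n)
  from Suc.prems(1) show ?case
  proof (cases rule: irreducible_cases)
    case (2 t)
    then show ?thesis
      using Suc merge_length merge_Nil merge_sprod by (metis Suc_inject)
  qed (use Suc in blast)
qed simp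

section \<open>The equivalence generated by merges\<close>

definition conn :: "'a list \<Rightarrow> 'a list \<Rightarrow> bool" where
  "conn = equivclp merge"

lemma conn_refl [simp]: "conn s s"
  by (simp add: conn_def)

lemma conn_sym: "conn s t \<Longrightarrow> conn t s"
  unfolding conn_def by (rule equivclp_sym)

lemma conn_trans [trans]: "conn s t \<Longrightarrow> conn t u \<Longrightarrow> conn s u"
  unfolding conn_def by (rule equivclp_trans)

lemma merge_conn: "merge s t \<Longrightarrow> conn s t"
  by (auto simp: conn_def)

lemma conn_Cons: "conn s t \<Longrightarrow> conn (x # s) (x # t)"
  unfolding conn_def
proof (induction rule: equivclp_induct)
  case (step t u)
  then show ?case
    by (metis merge_Cons equivclp_sym equivclp_trans r_into_equivclp)
qed simp

lemma merge_append: "merge s t \<Longrightarrow> merge (s @ u) (t @ u)"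
  by (induction rule: merge.induct) (auto intro: merge.intros)

lemma conn_append_right: "conn s t \<Longrightarrow> conn (s @ u) (t @ u)"
  unfolding conn_def
proof (induction rule: equivclp_induct)
  case (step t v)
  then show ?case
    by (metis merge_append equivclp_sym equivclp_trans r_into_equivclp)
qed simp

lemma conn_append_left: "conn s t \<Longrightarrow> conn (u @ s) (u @ t)"
  by (induction u) (auto intro: conn_Cons)

lemma conn_append: "conn s t \<Longrightarrow> conn s' t' \<Longrightarrow> conn (s @ s') (t @ t')"
  using conn_append_left conn_append_right conn_trans by blast

lemma conn_fingerprint: "conn s t \<Longrightarrow> fingerprint s = fingerprint t"
  unfolding conn_def
proof (induction rule: equivclp_induct)
  case (step t u)
  then show ?case
    using fingerprint_invariant by metis
qed simp

lemma conn_irreducible: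
  assumes "conn s t" "irreducible s" "irreducible t"
  shows "map (two_sided_ideal S) s = map (two_sided_ideal S) t"
proof -
  have "fingerprint s = map (two_sided_ideal S) s" if "irreducible s" for s
    using that merge_irreducible fingerprint_stuck by blast
  then show ?thesis
    using assms conn_fingerprint by metis
qed

end


section \<open>Multiplying irreducible factorisations\<close>

text \<open>\<open>stable_R\<close> and \<open>stable_L\<close> ask for stability at factors only;
  \<open>green_R_stable\<close> and \<open>green_L_stable\<close> extend it to the whole semigroup.
  In \<open>unique\<close> the order of the J-classes is forgotten, since the rank below is a
  multiset.\<close>

locale stable_factor_set = factor_set +
  assumes generated: "x \<in> carrier S \<Longrightarrow> \<exists>s. s \<noteq> [] \<and> set s \<subseteq> N \<and> sprod S s = x"
    and unique: "irreducible s \<Longrightarrow> irreducible t \<Longrightarrow> s \<noteq> [] \<Longrightarrow> t \<noteq> [] \<Longrightarrow> sprod S s = sprod S t \<Longrightarrow>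
      mset (map (two_sided_ideal S) s) = mset (map (two_sided_ideal S) t)"
    and stable_R: "x \<in> N \<Longrightarrow> v \<in> carrier S \<Longrightarrow> two_sided_ideal S (x \<cdot> v) = two_sided_ideal S x \<Longrightarrow>
      (x \<cdot> v, x) \<in> green_R S"
    and stable_L: "x \<in> N \<Longrightarrow> v \<in> carrier S \<Longrightarrow> two_sided_ideal S (v \<cdot> x) = two_sided_ideal S x \<Longrightarrow>
      (v \<cdot> x, x) \<in> green_L S"
begin

abbreviation "J \<equiv> two_sided_ideal S"

lemma J_mult_subset: "x \<in> carrier S \<Longrightarrow> s \<in> carrier S \<Longrightarrow> J (x \<cdot> s) \<subseteq> J x"
  by (simp add: two_sided_ideal_mono two_sided_idealI)

lemma irreducible_carrier: "irreducible s \<Longrightarrow> set s \<subseteq> carrier S"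
  using N_carrier by (auto simp: irreducible_def)

lemma irreducible_snoc:
  "irreducible (s @ [z]) \<longleftrightarrow> irreducible s \<and> z \<in> N \<and> (s \<noteq> [] \<longrightarrow> last s \<cdot> z \<notin> N)"
  by (auto simp: irreducible_def successively_append_iff)

text \<open>The last factor may vary in its R-class: R is a left congruence and \<open>N\<close> is
  a union of R-classes, so the product with the preceding factor stays outside
  \<open>N\<close>.\<close>

lemma irreducible_snoc_cong:
  assumes "irreducible (us @ [w])" "(w, w') \<in> green_R S"
  shows "irreducible (us @ [w'])"
    and "map J (us @ [w']) = map J (us @ [w])"
proof -
  have "us \<noteq> [] \<Longrightarrow> last us \<in> carrier S"
    using assms irreducible_carrier by fastforce
  then have "us \<noteq> [] \<Longrightarrow> (last us \<cdot> w', last us \<cdot> w) \<in> green_R S"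
    using assms green_R_cong green_R_sym by blast
  then show "irreducible (us @ [w'])"
    using assms N_R unfolding irreducible_snoc by blast
  show "map J (us @ [w']) = map J (us @ [w])"
    using assms green_R_imp_J by auto
qed

lemma sprod_snoc_cong:
  assumes "set (us @ [w]) \<subseteq> carrier S" "(w, w') \<in> green_R S"
  shows "(sprod S (us @ [w]), sprod S (us @ [w'])) \<in> green_R S"
proof (cases "us = []")
  case False
  then show ?thesis
    using assms green_R_carrier by (auto simp: sprod_append sprod_closed intro!: green_R_cong)
qed (use assms in simp)

lemma sprod_snoc_mult:
  assumes "set (us @ [w]) \<subseteq> carrier S" "v \<in> carrier S"
  shows "sprod S (us @ [w]) \<cdot> v = sprod S (us @ [w \<cdot> v])"
  using assms by (cases "us = []") (auto simp: sprod_append sprod_closed assoc)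

text \<open>
  As long as the new last factor \<open>z\<close> can be merged with the factor \<open>w\<close> in front of it, the result is
  \<open>\<L>\<close>-related to \<open>z\<close>: it cannot be \<open>\<R>\<close>-related to \<open>w\<close>, since then \<open>w\<close> could have been merged with
  the factor following it in the beginning.
\<close>

lemma irreducible_append_factor:
  assumes "irreducible s" "z \<in> N" "s \<noteq> [] \<Longrightarrow> (last s \<cdot> z, last s) \<notin> green_R S"
  shows "\<exists>k z'. irreducible (take k s @ [z']) \<and> sprod S (take k s @ [z']) = sprod S (s @ [z]) \<and>
    (z', z) \<in> green_L S \<and> (\<forall>w\<in>set (drop k s). J z \<subset> J w)"
  using assms
proof (induction s arbitrary: z rule: rev_induct)
  case Nil
  then show ?case
    using green_L_refl by (intro exI [of _ 0] exI [of _ z]) (simp add: irreducible_def)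
next
  case (snoc w us)
  have C: "z \<in> carrier S" "w \<in> carrier S" "w \<in> N" "irreducible us" "set us \<subseteq> carrier S"
    using snoc.prems irreducible_carrier by (auto simp: irreducible_snoc)
  show ?case
  proof (cases "w \<cdot> z \<in> N")
    case False
    have "irreducible ((us @ [w]) @ [z])"
      using False snoc.prems by (subst irreducible_snoc) auto
    then show ?thesis
      using green_L_refl C by (intro exI [of _ "Suc (length us)"] exI [of _ z]) simp
  next
    case True
    have L: "(w \<cdot> z, z) \<in> green_L S"
      using N_split [OF \<open>w \<in> N\<close> \<open>z \<in> N\<close> True] snoc.prems(3) by auto
    have "(last us \<cdot> (w \<cdot> z), last us) \<notin> green_R S" if "us \<noteq> []"
    proof
      have v: "last us \<in> N" "last us \<cdot> w \<notin> N"
        using snoc.prems that by (auto simp: irreducible_def successively_append_iff)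
      assume "(last us \<cdot> (w \<cdot> z), last us) \<in> green_R S"
      then have "(last us \<cdot> w, last us) \<in> green_R S"
        using v C by (intro green_R_between [of _ w z]) (auto simp: assoc)
      then show False
        using v N_R green_R_sym by blast
    qed
    then obtain k z' where k: "irreducible (take k us @ [z'])"
      "sprod S (take k us @ [z']) = sprod S (us @ [w \<cdot> z])"
      "(z', w \<cdot> z) \<in> green_L S" "\<forall>w'\<in>set (drop k us). J (w \<cdot> z) \<subset> J w'"
      using snoc.IH [OF C(4) True] by blast
    \<comment> \<open>\<open>k\<close> may exceed \<open>length us\<close>; it is cut down so that
      \<open>w\<close> is always among the dropped factors.\<close>
    define k' where "k' = min k (length us)"
    \<comment> \<open>By stability at the factor w, equal ideals would give wz R w, which is
      excluded by assumption.\<close>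
    have "J (w \<cdot> z) \<noteq> J w"
      using stable_R [OF \<open>w \<in> N\<close> \<open>z \<in> carrier S\<close>] snoc.prems(3) by auto
    then have "J (w \<cdot> z) \<subset> J w"
      using J_mult_subset C by blast
    moreover have "J (w \<cdot> z) = J z"
      using L by (rule green_L_imp_J)
    moreover have "(z', z) \<in> green_L S"
      using L k green_L_trans by blast
    moreover have "take k' (us @ [w]) = take k us" "set (drop k' (us @ [w])) = insert w (set (drop k us))"
      by (auto simp: k'_def min_def)
    moreover have "sprod S (us @ [w \<cdot> z]) = sprod S ((us @ [w]) @ [z])"
      using sprod_snoc_mult [of us w z] sprod_append [of "us @ [w]" "[z]"] C by simp
    ultimately show ?thesis
      using k by (intro exI [of _ k'] exI [of _ z']) auto
  qed
qed

text \<open>The order \<open>multp (\<supset>)\<close> makes smaller ideals count as larger. The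
  dropped factors are replaced by the single J-class of z, which is strictly below each of them; if
  none is dropped, the multiset gains an element. Either way it grows strictly.\<close>

lemma irreducible_mult_factor:
  assumes "irreducible (us @ [w])" "e \<in> N"
  shows "(w \<cdot> e, w) \<in> green_R S \<or>
    (\<exists>t. irreducible t \<and> t \<noteq> [] \<and> sprod S t = sprod S (us @ [w]) \<cdot> e \<and>
      multp (\<supset>) (mset (map J (us @ [w]))) (mset (map J t)))"
proof (cases "(w \<cdot> e, w) \<in> green_R S")
  case False
  let ?s = "us @ [w]"
  obtain k z where k: "irreducible (take k ?s @ [z])"
    "sprod S (take k ?s @ [z]) = sprod S (?s @ [e])" "(z, e) \<in> green_L S"
    "\<forall>w\<in>set (drop k ?s). J e \<subset> J w"
    using irreducible_append_factor [OF assms] False by auto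
  have "sprod S (?s @ [e]) = sprod S ?s \<cdot> e"
    using assms irreducible_carrier [OF assms(1)] by (subst sprod_append) auto
  moreover have "multp (\<supset>) (mset (map J (take k ?s)) + mset (map J (drop k ?s)))
      (mset (map J (take k ?s)) + {#J z#})"
    using k(3,4) green_L_imp_J by (intro one_step_implies_multp) (auto simp: set_drop_subset)
  moreover have "mset (map J (take k ?s)) + mset (map J (drop k ?s)) = mset (map J ?s)"
    by (metis append_take_drop_id map_append mset_append)
  ultimately show ?thesis
    using k by (metis append_is_Nil_conv list.simps(3,8,9) map_append mset.simps mset_append)
qed blast

lemma transp_multp_supset: "transp (multp ((\<supset>) :: 'a set \<Rightarrow> 'a set \<Rightarrow> bool))"
  by (rule transp_multp) (auto simp: transp_def)

lemma irreflp_multp_supset: "\<not> multp ((\<supset>) :: 'a set \<Rightarrow> 'a set \<Rightarrow> bool) A A"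
proof -
  have "irreflp (multp ((\<supset>) :: 'a set \<Rightarrow> 'a set \<Rightarrow> bool))"
    by (rule irreflp_multp) (auto simp: transp_def irreflp_def)
  then show ?thesis
    by (simp add: irreflp_def)
qed

text \<open>Multiply by the factors of v one at a time. As long as the last factor stays in the
  R-class of w, only that factor is altered. After a first strict growth, each further
  multiplication keeps the multiset or enlarges it again, so the growth persists.\<close>

lemma irreducible_mult:
  assumes "irreducible (us @ [w])" "v \<in> carrier S"
  shows "(w \<cdot> v, w) \<in> green_R S \<or>
    (\<exists>t. irreducible t \<and> t \<noteq> [] \<and> sprod S t = sprod S (us @ [w]) \<cdot> v \<and>
      multp (\<supset>) (mset (map J (us @ [w]))) (mset (map J t)))"
proof -
  have w: "w \<in> carrier S" "set us \<subseteq> carrier S" "sprod S (us @ [w]) \<in> carrier S"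
    using irreducible_carrier [OF assms(1)] by (auto intro!: sprod_closed)
  obtain s where s: "s \<noteq> []" "set s \<subseteq> N" "sprod S s = v"
    using generated assms by blast
  have "(w \<cdot> sprod S s, w) \<in> green_R S \<or>
      (\<exists>t. irreducible t \<and> t \<noteq> [] \<and> sprod S t = sprod S (us @ [w]) \<cdot> sprod S s \<and>
        multp (\<supset>) (mset (map J (us @ [w]))) (mset (map J t)))" (is "?R s \<or> ?T s")
    using s(1,2)
  proof (induction s rule: rev_nonempty_induct)
    case (single e)
    then show ?case
      using irreducible_mult_factor assms by simp
  next
    case (snoc e s)
    have C: "sprod S s \<in> carrier S" "e \<in> N" "e \<in> carrier S" "sprod S (s @ [e]) = sprod S s \<cdot> e"
      using snoc N_carrier by (auto simp: sprod_append sprod_closed)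
    have "?R s \<or> ?T s"
      using snoc by auto
    then show ?case
    proof
      assume R: "?R s"
      note irr = irreducible_snoc_cong [OF assms(1) green_R_sym [OF R]]
      have "(w \<cdot> sprod S s \<cdot> e, w) \<in> green_R S" if "(w \<cdot> sprod S s \<cdot> e, w \<cdot> sprod S s) \<in> green_R S"
        using that R green_R_trans by blast
      moreover have "sprod S (us @ [w \<cdot> sprod S s]) = sprod S (us @ [w]) \<cdot> sprod S s"
        using w C by (simp add: sprod_snoc_mult)
      ultimately show ?case
        using irreducible_mult_factor [OF irr(1) \<open>e \<in> N\<close>] irr(2) C w
        by (auto simp: assoc)
    next
      assume "?T s"
      then obtain t where t: "irreducible t" "t \<noteq> []" "sprod S t = sprod S (us @ [w]) \<cdot> sprod S s"
        "multp (\<supset>) (mset (map J (us @ [w]))) (mset (map J t))"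
        by blast
      obtain ts z where tz: "t = ts @ [z]"
        using t(2) by (cases t rule: rev_cases) auto
      have z: "z \<in> carrier S" "set ts \<subseteq> carrier S"
        using irreducible_carrier [OF t(1)] tz by auto
      have "\<exists>t'. irreducible t' \<and> t' \<noteq> [] \<and> sprod S t' = sprod S t \<cdot> e \<and>
          multp (\<supset>) (mset (map J (us @ [w]))) (mset (map J t'))"
      proof (cases "(z \<cdot> e, z) \<in> green_R S")
        case True
        have "irreducible (ts @ [z \<cdot> e])" "map J (ts @ [z \<cdot> e]) = map J t"
          using irreducible_snoc_cong [of ts z "z \<cdot> e"] True t(1) tz green_R_sym by auto
        then show ?thesis
          using t tz z C sprod_snoc_mult [of ts z e] by (intro exI [of _ "ts @ [z \<cdot> e]"]) auto
      next
        case False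
        then obtain t' where "irreducible t'" "t' \<noteq> []" "sprod S t' = sprod S t \<cdot> e"
          "multp (\<supset>) (mset (map J t)) (mset (map J t'))"
          using irreducible_mult_factor t(1) tz \<open>e \<in> N\<close> by blast
        then show ?thesis
          using t(4) transp_multp_supset [THEN transpD] by blast
      qed
      then show ?case
        using t C w by (simp add: assoc)
    qed
  qed
  then show ?thesis
    using s by simp
qed

text \<open>By \<open>unique\<close> the choice of factorisation does not matter. The rank measures
  the position in the J-order: by \<open>rank_ideal\<close> it can only stay or grow when passing to
  an element of the principal ideal.\<close>

definition rank :: "'a \<Rightarrow> 'a set multiset" where
  "rank x = mset (map J (SOME s. irreducible s \<and> s \<noteq> [] \<and> sprod S s = x))"

lemma rank_eq:
  assumes "irreducible s" "s \<noteq> []" "sprod S s = x"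
  shows "rank x = mset (map J s)"
proof -
  define t where "t = (SOME s. irreducible s \<and> s \<noteq> [] \<and> sprod S s = x)"
  have t: "irreducible t \<and> t \<noteq> [] \<and> sprod S t = x"
    unfolding t_def by (rule someI [of _ s]) (use assms in blast)
  then have "mset (map J t) = mset (map J s)"
    using assms by (intro unique) auto
  then show ?thesis
    by (simp add: rank_def t_def)
qed

lemma irreducibleE:
  assumes "x \<in> carrier S"
  obtains s where "irreducible s" "s \<noteq> []" "sprod S s = x"
  using assms generated ex_irreducible by metis

lemma rank_mult_right:
  assumes "x \<in> carrier S" "v \<in> carrier S"
  shows "rank (x \<cdot> v) = rank x \<or> multp (\<supset>) (rank x) (rank (x \<cdot> v))"
proof -
  obtain s where s: "irreducible s" "s \<noteq> []" "sprod S s = x"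
    using assms irreducibleE by blast
  obtain us w where us: "s = us @ [w]"
    using s(2) by (cases s rule: rev_cases) auto
  show ?thesis
  proof (cases "(w \<cdot> v, w) \<in> green_R S")
    case True
    then have *: "irreducible (us @ [w \<cdot> v])" "map J (us @ [w \<cdot> v]) = map J s"
      using irreducible_snoc_cong [of us w "w \<cdot> v"] s(1) us green_R_sym by auto
    have "sprod S (us @ [w \<cdot> v]) = x \<cdot> v"
      using sprod_snoc_mult s us irreducible_carrier assms by metis
    then show ?thesis
      using rank_eq [OF *(1)] rank_eq [OF s] *(2) by (metis snoc_eq_iff_butlast)
  next
    case False
    then obtain t where "irreducible t" "t \<noteq> []" "sprod S t = x \<cdot> v"
      "multp (\<supset>) (mset (map J s)) (mset (map J t))"
      using irreducible_mult [of us w v] s us assms by blast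
    then show ?thesis
      using rank_eq s by simp
  qed
qed

section \<open>Left-right duality for factor sets and the rank\<close>

lemma factor_set_opp: "factor_set (opp S) N"
  using sgrp_opp
proof (rule factor_set.intro)
  show "factor_set_axioms (opp S) N"
  proof
    show "N \<subseteq> carrier (opp S)"
      using N_carrier by simp
    show "y \<in> N" if "x \<in> N" "(x, y) \<in> green_R (opp S)" for x y
      using N_L [OF that(1)] that(2) by simp
    show "y \<in> N" if "x \<in> N" "(x, y) \<in> green_L (opp S)" for x y
      using N_R [OF that(1)] that(2) by simp
    show "(x \<cdot>\<^bsub>opp S\<^esub> y, x) \<in> green_R (opp S) \<or> (x \<cdot>\<^bsub>opp S\<^esub> y, y) \<in> green_L (opp S)"
      if "x \<in> N" "y \<in> N" "x \<cdot>\<^bsub>opp S\<^esub> y \<in> N" for x y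
      using N_split [OF that(2,1)] that(3) by auto
  qed
qed

lemma irreducible_opp: "factor_set.irreducible (opp S) N s \<longleftrightarrow> irreducible (rev s)"
  using factor_set.irreducible_def [OF factor_set_opp] by (simp add: irreducible_def)

lemma map_J_opp: "set s \<subseteq> N \<Longrightarrow> map (two_sided_ideal (opp S)) s = map J s"
  using two_sided_ideal_opp by auto

lemma sprod_opp': "s \<noteq> [] \<Longrightarrow> set s \<subseteq> carrier S \<Longrightarrow> sprod (opp S) s = sprod S (rev s)"
  using sprod_opp [of "rev s"] by simp

lemma stable_factor_set_opp: "stable_factor_set (opp S) N"
  using factor_set_opp
proof (rule stable_factor_set.intro)
  show "stable_factor_set_axioms (opp S) N"
  proof
    fix x assume "x \<in> carrier (opp S)"
    then obtain s where "s \<noteq> []" "set s \<subseteq> N" "sprod S s = x"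
      using generated by auto
    then show "\<exists>s. s \<noteq> [] \<and> set s \<subseteq> N \<and> sprod (opp S) s = x"
      using sprod_opp [of s] N_carrier by (intro exI [of _ "rev s"]) auto
  next
    fix s t
    assume s: "factor_set.irreducible (opp S) N s" "s \<noteq> []"
      and t: "factor_set.irreducible (opp S) N t" "t \<noteq> []"
      and eq: "sprod (opp S) s = sprod (opp S) t"
    have N: "set s \<subseteq> N" "set t \<subseteq> N"
      using s t by (auto simp: irreducible_opp irreducible_def)
    then have "sprod S (rev s) = sprod S (rev t)"
      using eq s t sprod_opp' N_carrier by (metis order_trans)
    then have "mset (map J (rev s)) = mset (map J (rev t))"
      using s t by (intro unique) (auto simp: irreducible_opp)
    then show "mset (map (two_sided_ideal (opp S)) s) = mset (map (two_sided_ideal (opp S)) t)"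
      using N by (simp add: map_J_opp flip: rev_map)
  next
    fix x s assume "x \<in> N" "s \<in> carrier (opp S)"
      and "two_sided_ideal (opp S) (x \<cdot>\<^bsub>opp S\<^esub> s) = two_sided_ideal (opp S) x"
    then show "(x \<cdot>\<^bsub>opp S\<^esub> s, x) \<in> green_R (opp S)"
      using stable_L by (simp add: two_sided_ideal_opp)
  next
    fix x s assume "x \<in> N" "s \<in> carrier (opp S)"
      and "two_sided_ideal (opp S) (s \<cdot>\<^bsub>opp S\<^esub> x) = two_sided_ideal (opp S) x"
    then show "(s \<cdot>\<^bsub>opp S\<^esub> x, x) \<in> green_L (opp S)"
      using stable_R by (simp add: two_sided_ideal_opp)
  qed
qed

lemma rank_opp:
  assumes "x \<in> carrier S"
  shows "stable_factor_set.rank (opp S) N x = rank x"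
proof -
  obtain s where s: "irreducible s" "s \<noteq> []" "sprod S s = x"
    using assms irreducibleE by blast
  have "sprod (opp S) (rev s) = x"
    using s irreducible_carrier sprod_opp by blast
  then have "stable_factor_set.rank (opp S) N x = mset (map (two_sided_ideal (opp S)) (rev s))"
    using s by (intro stable_factor_set.rank_eq [OF stable_factor_set_opp]) (auto simp: irreducible_opp)
  also have "\<dots> = mset (map J s)"
    using arg_cong [OF map_J_opp [of s], of mset] s by (simp add: irreducible_def)
  finally show ?thesis
    using rank_eq [OF s] by simp
qed

lemma rank_mult_left:
  assumes "x \<in> carrier S" "v \<in> carrier S"
  shows "rank (v \<cdot> x) = rank x \<or> multp (\<supset>) (rank x) (rank (v \<cdot> x))"
  using stable_factor_set.rank_mult_right [OF stable_factor_set_opp, of x v] assms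
  by (simp add: rank_opp)

lemma rank_ideal:
  assumes "x \<in> carrier S" "y \<in> J x"
  shows "rank y = rank x \<or> multp (\<supset>) (rank x) (rank y)"
proof -
  obtain z where z: "z \<in> left_ideal S x" "y \<in> right_ideal S z"
    using assms two_sided_ideal_iff by blast
  then have C: "z \<in> carrier S"
    using assms left_ideal_carrier by blast
  have "rank z = rank x \<or> multp (\<supset>) (rank x) (rank z)"
    using z(1) assms rank_mult_left by (auto elim!: left_idealE)
  moreover have "rank y = rank z \<or> multp (\<supset>) (rank z) (rank y)"
    using z(2) C rank_mult_right by (auto elim!: right_idealE)
  ultimately show ?thesis
    using transp_multp_supset [THEN transpD] by metis
qed

section \<open>Stability and Green's relations of arbitrary elements\<close>

lemma last_factor_stable:
  assumes irr: "irreducible (us @ [w])" and v: "v \<in> carrier S"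
    and J: "J (sprod S (us @ [w]) \<cdot> v) = J (sprod S (us @ [w]))"
  shows "(w \<cdot> v, w) \<in> green_R S"
proof (rule ccontr)
  let ?x = "sprod S (us @ [w])"
  have C: "?x \<in> carrier S"
    using irreducible_carrier [OF irr] by (intro sprod_closed) auto
  assume "(w \<cdot> v, w) \<notin> green_R S"
  then obtain t where "irreducible t" "t \<noteq> []" "sprod S t = ?x \<cdot> v"
    "multp (\<supset>) (mset (map J (us @ [w]))) (mset (map J t))"
    using irreducible_mult [OF irr v] by blast
  then have less: "multp (\<supset>) (rank ?x) (rank (?x \<cdot> v))"
    using rank_eq irr by (metis snoc_eq_iff_butlast)
  have "?x \<in> J (?x \<cdot> v)"
    using J C two_sided_idealI(1) by blast
  then have "rank ?x = rank (?x \<cdot> v) \<or> multp (\<supset>) (rank (?x \<cdot> v)) (rank ?x)"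
    using rank_ideal C v by blast
  then show False
    using less transp_multp_supset [THEN transpD] irreflp_multp_supset by metis
qed

theorem green_R_irreducible_iff:
  assumes irr: "irreducible (us @ [w])"
  shows "(sprod S (us @ [w]), y) \<in> green_R S \<longleftrightarrow> (\<exists>w'. (w, w') \<in> green_R S \<and> y = sprod S (us @ [w']))"
    (is "(?x, y) \<in> green_R S \<longleftrightarrow> ?rhs")
proof
  have C: "set (us @ [w]) \<subseteq> carrier S"
    using irr irreducible_carrier by blast
  show "(?x, y) \<in> green_R S" if ?rhs
    using that C sprod_snoc_cong by blast
  assume R: "(?x, y) \<in> green_R S"
  then have "y \<in> right_ideal S ?x"
    by (simp add: green_R_iff)
  then show ?rhs
  proof (cases rule: right_idealE)
    case 1
    then show ?thesis
      using C green_R_refl by auto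
  next
    case (2 v)
    then have "(w \<cdot> v, w) \<in> green_R S"
      using last_factor_stable [OF irr] R green_R_imp_J by simp
    then show ?thesis
      using 2 C sprod_snoc_mult green_R_sym by blast
  qed
qed

theorem green_L_irreducible_iff:
  assumes irr: "irreducible (w # us)"
  shows "(sprod S (w # us), y) \<in> green_L S \<longleftrightarrow> (\<exists>w'. (w, w') \<in> green_L S \<and> y = sprod S (w' # us))"
proof -
  have C: "set (w # us) \<subseteq> carrier S"
    using irr irreducible_carrier by blast
  have "(w, w') \<in> green_L S \<Longrightarrow> sprod (opp S) (rev us @ [w']) = sprod S (w' # us)" for w'
    using C green_L_carrier sprod_opp [of "w' # us"] by auto
  then show ?thesis
    using stable_factor_set.green_R_irreducible_iff [OF stable_factor_set_opp, of "rev us" w y]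
      irr C sprod_opp [of "w # us"] by (auto simp: irreducible_opp)
qed

text \<open>An irreducible factorisation reduces the claim to its last factor w: wv R w is preserved
  when the other factors are multiplied on from the left.\<close>

lemma green_R_stable:
  assumes "x \<in> carrier S" "v \<in> carrier S" "J (x \<cdot> v) = J x"
  shows "(x \<cdot> v, x) \<in> green_R S"
proof -
  obtain s where s: "irreducible s" "s \<noteq> []" "sprod S s = x"
    using assms irreducibleE by blast
  obtain us w where us: "s = us @ [w]"
    using s(2) by (cases s rule: rev_cases) auto
  have "(w \<cdot> v, w) \<in> green_R S"
    using last_factor_stable [of us w v] s us assms by simp
  then show ?thesis
    using sprod_snoc_cong [of us w "w \<cdot> v"] sprod_snoc_mult [of us w v] irreducible_carrier s us
      assms green_R_sym by metis
qed

lemma green_L_stable: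
  assumes "x \<in> carrier S" "v \<in> carrier S" "J (v \<cdot> x) = J x"
  shows "(v \<cdot> x, x) \<in> green_L S"
  using stable_factor_set.green_R_stable [OF stable_factor_set_opp, of x v] assms
  by (simp add: two_sided_ideal_opp)

text \<open>Stable semigroups satisfy D = J: if y J x, reach y from x by a right multiplication to z
  followed by a left one. Then z is J-equivalent to both, so stability makes the first step R and
  the second L.\<close>

theorem green_D_eq_J: "green_D S = green_J S"
proof -
  have "(x, y) \<in> green_D S" if xy: "(x, y) \<in> green_J S" for x y
  proof -
    have C: "x \<in> carrier S" "y \<in> carrier S" and J: "J x = J y"
      using xy by (auto simp: green_J_def)
    then have "y \<in> J x"
      using two_sided_idealI by blast
    then obtain z where z: "z \<in> right_ideal S x" "y \<in> left_ideal S z"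
      using C two_sided_ideal_iff' by blast
    have zC: "z \<in> carrier S"
      using z C right_ideal_carrier by blast
    have "z \<in> J x" "y \<in> J z"
      using z C zC two_sided_ideal_iff' left_idealI(1) right_idealI(1) by blast+
    then have Jz: "J z = J x"
      using J two_sided_ideal_mono C zC by blast
    have "(z, x) \<in> green_R S"
      using z(1) C Jz green_R_stable green_R_refl by (auto elim!: right_idealE)
    moreover have "(y, z) \<in> green_L S"
      using z(2) zC Jz J green_L_stable green_L_refl by (auto elim!: left_idealE)
    ultimately show ?thesis
      using green_D_iff green_R_sym green_L_sym by blast
  qed
  moreover have "(x, y) \<in> green_J S" if "(x, y) \<in> green_D S" for x y
    using that green_D_imp_J green_D_carrier by (auto simp: green_J_def)
  ultimately show ?thesis
    by auto
qed

text \<open>Let x y x = x and suppose that an irreducible factorisation of x ends in v, w. Since x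
  (y x) = x, the last factor satisfies w (y x) R w, so J w is contained in J x, hence in J (v w).
  Stability at w gives vw L w, so v and w could have been merged. Thus x has just one
  factor.\<close>

lemma regular_imp_factor:
  assumes "regular S x"
  shows "x \<in> N"
proof -
  obtain y where y: "x \<in> carrier S" "y \<in> carrier S" "x \<cdot> (y \<cdot> x) = x"
    using assms by (auto simp: regular_iff)
  obtain s where s: "irreducible s" "s \<noteq> []" "sprod S s = x"
    using y irreducibleE by blast
  obtain us w where us: "s = us @ [w]"
    using s(2) by (cases s rule: rev_cases) auto
  show ?thesis
  proof (cases "us = []")
    case True
    then show ?thesis
      using s us by (simp add: irreducible_def)
  next
    case False
    then obtain vs v where vs: "us = vs @ [v]"
      by (cases us rule: rev_cases) auto
    have N: "w \<in> N" "v \<in> N" "v \<cdot> w \<notin> N"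
      using s(1) us vs by (auto simp: irreducible_def successively_append_iff)
    have "(w \<cdot> (y \<cdot> x), w) \<in> green_R S"
      using last_factor_stable [of us w "y \<cdot> x"] s us y by simp
    then have "J w = J (w \<cdot> (y \<cdot> x))"
      using green_R_imp_J by simp
    also have "\<dots> \<subseteq> J x"
      using N y two_sided_ideal_mono two_sided_idealI(3) [of x "w \<cdot> y"] by (simp add: assoc)
    also have "J x \<subseteq> J (v \<cdot> w)"
    proof -
      have "x \<in> left_ideal S (v \<cdot> w)"
      proof (cases "vs = []")
        case False
        have "set vs \<subseteq> carrier S"
          using irreducible_carrier [OF s(1)] us vs by auto
        then have "x = sprod S vs \<cdot> (v \<cdot> w)"
          using s(3) us vs N False sprod_append [of vs "[v, w]"] by simp
        then show ?thesis
          using \<open>set vs \<subseteq> carrier S\<close> False sprod_closed by auto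
      qed (use s us vs in auto)
      then have "x \<in> J (v \<cdot> w)"
        using two_sided_ideal_iff right_idealI(1) by blast
      then show ?thesis
        using N two_sided_ideal_mono by blast
    qed
    finally have "J w \<subseteq> J (v \<cdot> w)" .
    moreover have "J (v \<cdot> w) \<subseteq> J w"
      using N by (simp add: two_sided_ideal_mono two_sided_idealI)
    ultimately have "J (v \<cdot> w) = J w"
      by blast
    then have "(v \<cdot> w, w) \<in> green_L S"
      using N stable_L by blast
    then show ?thesis
      using N N_L green_L_sym by blast
  qed
qed

end


section \<open>Regular \<open>\<D>\<close>-classes identified with Rees matrix semigroups\<close>

context sgrp
begin

lemma regular_opp: "regular (opp S) x \<longleftrightarrow> regular S x"
  by (auto simp: regular_def assoc)

lemma regularE:
  assumes "regular S x"
  obtains e where "e \<in> carrier S" "e \<cdot> e = e" "x \<cdot> e = x" "(e, x) \<in> green_L S"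
proof -
  obtain y where y: "x \<in> carrier S" "y \<in> carrier S" "x \<cdot> (y \<cdot> x) = x"
    using assms by (auto simp: regular_iff)
  have "x \<in> left_ideal S (y \<cdot> x)"
    using y left_idealI(2) [of x "y \<cdot> x"] by simp
  then have "(y \<cdot> x, x) \<in> green_L S"
    using y by (simp add: green_L_iff)
  then show ?thesis
    using y that [of "y \<cdot> x"] by (simp add: assoc)
qed

text \<open>
  If \<open>e = p e s q\<close> for an idempotent \<open>e\<close>, then \<open>r = e s q e\<close> satisfies \<open>r \<L> e\<close>, hence \<open>r \<in> D\<close>; now the
  hypothesis on \<open>D\<close> gives \<open>r \<R> e\<close>, and \<open>e s\<close> lies in between.
\<close>

lemma stable_if_stable_in_class:
  assumes D: "\<And>x. x \<in> D \<Longrightarrow> regular S x" "\<And>x y. x \<in> D \<Longrightarrow> (x, y) \<in> green_L S \<Longrightarrow> y \<in> D"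
    and stable: "\<And>x s. x \<in> D \<Longrightarrow> s \<in> carrier S \<Longrightarrow> x \<cdot> s \<in> D \<Longrightarrow> (x \<cdot> s, x) \<in> green_R S"
    and x: "x \<in> D" "s \<in> carrier S" "two_sided_ideal S (x \<cdot> s) = two_sided_ideal S x"
  shows "(x \<cdot> s, x) \<in> green_R S"
proof -
  have C: "x \<in> carrier S" "s \<in> carrier S"
    using D(1) [OF x(1)] x(2) by (auto simp: regular_def)
  obtain e where e: "e \<in> carrier S" "e \<cdot> e = e" "x \<cdot> e = x" "(e, x) \<in> green_L S"
    using regularE D(1) [OF x(1)] by blast
  have eD: "e \<in> D"
    using D(2) [OF x(1)] e(4) green_L_sym by blast
  have "(e \<cdot> s, x \<cdot> s) \<in> green_L S"
    using e(4) x(2) by (rule green_L_cong)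
  then have "two_sided_ideal S (e \<cdot> s) = two_sided_ideal S e"
    using x(3) e(4) green_L_imp_J by simp
  then have "e \<in> two_sided_ideal S (e \<cdot> s)"
    using e(1) two_sided_idealI(1) by blast
  \<comment> \<open>An absent multiplier is replaced by the idempotent e, since e e = e.\<close>
  then have "\<exists>p\<in>carrier S. \<exists>q\<in>carrier S. e = p \<cdot> (e \<cdot> s) \<cdot> q"
  proof -
    assume "e \<in> two_sided_ideal S (e \<cdot> s)"
    then consider "e = e \<cdot> s" | q where "q \<in> carrier S" "e = e \<cdot> s \<cdot> q"
      | p where "p \<in> carrier S" "e = p \<cdot> (e \<cdot> s)"
      | p q where "p \<in> carrier S" "q \<in> carrier S" "e = p \<cdot> (e \<cdot> s) \<cdot> q"
      unfolding two_sided_ideal_def by blast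
    then show ?thesis
    proof cases
      case 1
      then have "e \<cdot> (e \<cdot> s) \<cdot> e = e"
        using e by metis
      then show ?thesis
        using e(1) by metis
    next
      case (2 q)
      then have "e \<cdot> (e \<cdot> s) \<cdot> q = e"
        using e C by (metis assoc closed)
      then show ?thesis
        using 2(1) e(1) by metis
    next
      case (3 p)
      then have "p \<cdot> (e \<cdot> s) \<cdot> e = e"
        using e by metis
      then show ?thesis
        using 3(1) e(1) by metis
    next
      case 4
      then show ?thesis
        by blast
    qed
  qed
  then obtain p q where pq: "p \<in> carrier S" "q \<in> carrier S" "p \<cdot> (e \<cdot> s) \<cdot> q = e"
    by metis
  define r where "r = e \<cdot> (s \<cdot> q \<cdot> e)"
  have r: "r \<in> carrier S"
    using pq e C by (simp add: r_def)
  have "p \<cdot> r = p \<cdot> (e \<cdot> s) \<cdot> q \<cdot> e"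
    unfolding r_def using pq(1,2) e(1) C by (simp add: assoc)
  then have pr: "p \<cdot> r = e"
    using pq(3) e(2) by simp
  have "r = e \<cdot> (s \<cdot> q) \<cdot> e"
    unfolding r_def using pq(1,2) e(1) C by (simp add: assoc)
  then have "r \<in> left_ideal S e"
    using pq(2) e(1) C by auto
  moreover have "e \<in> left_ideal S r"
    using pr pq(1) by (metis left_idealI(2))
  ultimately have "(e, r) \<in> green_L S"
    using e(1) r by (simp add: green_L_iff)
  then have "r \<in> D"
    using D(2) eD by blast
  then have "(r, e) \<in> green_R S"
    using stable [OF eD, of "s \<cdot> q \<cdot> e"] pq(2) e(1) C by (simp add: r_def)
  then have "(e \<cdot> s \<cdot> (q \<cdot> e), e) \<in> green_R S"
    unfolding r_def using pq(2) e(1) C by (simp add: assoc)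
  then have "(e \<cdot> s, e) \<in> green_R S"
    using pq(2) e(1) C by (intro green_R_between [of e s "q \<cdot> e"]) auto
  then have "(x \<cdot> (e \<cdot> s), x \<cdot> e) \<in> green_R S"
    using C by (intro green_R_cong) auto
  then show ?thesis
    using e C by (simp flip: assoc)
qed

end

text \<open>The identification describes products that stay inside the D-class. It is not
  presupposed that this D-class fills its J-class; the passage from D to J is made in
  \<open>J_stable_R\<close> and \<open>J_stable_L\<close>.\<close>

locale rees_class = sgrp +
  fixes D :: "'a set" and M :: "('g, 'i, 'l) rees_data" and t :: "'i \<times> 'g \<times> 'l \<Rightarrow> 'a"
  assumes D_in: "D \<in> regular_D_classes S"
    and ident: "rees_identification S D M t"
begin

lemma D_regular: "x \<in> D \<Longrightarrow> regular S x"
  using D_in regular_D by (auto simp: regular_D_classes_def D_class_def)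

lemma D_carrier [simp, intro]: "x \<in> D \<Longrightarrow> x \<in> carrier S"
  using D_regular by (auto simp: regular_def)

lemma D_closed: "x \<in> D \<Longrightarrow> (x, y) \<in> green_D S \<Longrightarrow> y \<in> D"
  using D_in green_D_trans by (auto simp: regular_D_classes_def D_class_def)

lemma D_closed_R: "x \<in> D \<Longrightarrow> (x, y) \<in> green_R S \<Longrightarrow> y \<in> D"
  using D_closed green_R_imp_D by blast

lemma D_closed_L: "x \<in> D \<Longrightarrow> (x, y) \<in> green_L S \<Longrightarrow> y \<in> D"
  using D_closed green_L_imp_D by blast

lemma group_M: "group (grp M)"
  using ident by (simp add: rees_identification_def valid_rees_data_def)

lemma bij_M:
  "bij_betw (map_option t) (insert None (Some ` triples M)) (insert None (Some ` D))"
  using ident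
  by (simp add: rees_identification_def semigrp_iso_def rees_semigroup_def principal_factor_def)

lemma t_in: "z \<in> triples M \<Longrightarrow> t z \<in> D"
  using bij_betwE [OF bij_M, rule_format, of "Some z"] by auto

lemma t_surj:
  assumes "x \<in> D"
  obtains i g l where "i \<in> rows M" "g \<in> carrier (grp M)" "l \<in> cols M" "x = t (i, g, l)"
proof -
  have "Some x \<in> map_option t ` insert None (Some ` triples M)"
    using bij_betw_imp_surj_on [OF bij_M] assms by simp
  then show ?thesis
    using that by (auto simp: triples_def)
qed

lemma t_mult:
  assumes "(i, g, l) \<in> triples M" "(j, h, k) \<in> triples M"
  shows "map_option t (rees_mult M (Some (i, g, l)) (Some (j, h, k))) =
    factor_mult S D (Some (t (i, g, l))) (Some (t (j, h, k)))"
proof -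
  have "\<forall>x\<in>insert None (Some ` triples M). \<forall>y\<in>insert None (Some ` triples M).
      map_option t (rees_mult M x y) = factor_mult S D (map_option t x) (map_option t y)"
    using ident
    by (simp add: rees_identification_def semigrp_iso_def rees_semigroup_def principal_factor_def)
  from this [rule_format, of "Some (i, g, l)" "Some (j, h, k)"] show ?thesis
    using assms by simp
qed

lemma t_mult_Some:
  assumes "(i, g, l) \<in> triples M" "(j, h, k) \<in> triples M" "sandwich M l j = Some p"
  shows "t (i, g, l) \<cdot> t (j, h, k) = t (i, g \<otimes>\<^bsub>grp M\<^esub> p \<otimes>\<^bsub>grp M\<^esub> h, k)"
  using t_mult [OF assms(1,2)] assms(3) by (auto split: if_splits)

lemma sandwich_carrier:
  "l \<in> cols M \<Longrightarrow> i \<in> rows M \<Longrightarrow> sandwich M l i = Some p \<Longrightarrow> p \<in> carrier (grp M)"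
  using ident by (fastforce simp: rees_identification_def valid_rees_data_def)

lemma t_mult_in_D:
  assumes "(i, g, l) \<in> triples M" "(j, h, k) \<in> triples M" "t (i, g, l) \<cdot> t (j, h, k) \<in> D"
  obtains b where "b \<in> carrier (grp M)" "t (i, g, l) \<cdot> t (j, h, k) = t (i, b, k)"
proof -
  interpret G: group "grp M" by (rule group_M)
  have "sandwich M l j \<noteq> None"
    using t_mult [OF assms(1,2)] assms(3) by (auto split: option.splits)
  then obtain p where p: "sandwich M l j = Some p"
    by blast
  then have "p \<in> carrier (grp M)"
    using sandwich_carrier [of l j p] assms by (auto simp: triples_def)
  then show ?thesis
    using that [of "g \<otimes>\<^bsub>grp M\<^esub> p \<otimes>\<^bsub>grp M\<^esub> h"] t_mult_Some [OF assms(1,2) p] assms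
    by (simp add: triples_def)
qed

lemma row_green_R:
  assumes x: "(i, g, l) \<in> triples M" and y: "(i, h, k) \<in> triples M"
  shows "(t (i, g, l), t (i, h, k)) \<in> green_R S"
proof -
  interpret G: group "grp M" by (rule group_M)
  have *: "t (i, h, k) \<in> right_ideal S (t (i, g, l))"
    if x: "(i, g, l) \<in> triples M" and y: "(i, h, k) \<in> triples M" for g l h k
  proof -
    obtain j p where j: "j \<in> rows M" "sandwich M l j = Some p"
      using ident x by (force simp: rees_identification_def valid_rees_data_def triples_def)
    have C: "g \<in> carrier (grp M)" "p \<in> carrier (grp M)" "h \<in> carrier (grp M)"
      using x y j sandwich_carrier by (auto simp: triples_def)
    \<comment> \<open>The group component solves g p u = h for u.\<close>
    let ?z = "(j, inv\<^bsub>grp M\<^esub> (g \<otimes>\<^bsub>grp M\<^esub> p) \<otimes>\<^bsub>grp M\<^esub> h, k)"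
    have z: "?z \<in> triples M"
      using C j y by (simp add: triples_def)
    have "t (i, g, l) \<cdot> t ?z = t (i, h, k)"
      using t_mult_Some [OF x z j(2)] C by (simp add: G.m_assoc [symmetric])
    then show ?thesis
      using t_in [OF z] by (metis right_idealI(2) D_carrier)
  qed
  show ?thesis
    using *[OF x y] *[OF y x] t_in x y by (simp add: green_R_iff)
qed

lemma col_green_L:
  assumes x: "(i, g, l) \<in> triples M" and y: "(j, h, l) \<in> triples M"
  shows "(t (i, g, l), t (j, h, l)) \<in> green_L S"
proof -
  interpret G: group "grp M" by (rule group_M)
  have *: "t (j, h, l) \<in> left_ideal S (t (i, g, l))"
    if x: "(i, g, l) \<in> triples M" and y: "(j, h, l) \<in> triples M" for i j g h
  proof -
    obtain k p where k: "k \<in> cols M" "sandwich M k i = Some p"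
      using ident x by (force simp: rees_identification_def valid_rees_data_def triples_def)
    have C: "g \<in> carrier (grp M)" "p \<in> carrier (grp M)" "h \<in> carrier (grp M)"
      using x y k sandwich_carrier by (auto simp: triples_def)
    let ?z = "(j, h \<otimes>\<^bsub>grp M\<^esub> inv\<^bsub>grp M\<^esub> (p \<otimes>\<^bsub>grp M\<^esub> g), k)"
    have z: "?z \<in> triples M"
      using C k y by (simp add: triples_def)
    have "t ?z \<cdot> t (i, g, l) = t (j, h, l)"
      using t_mult_Some [OF z x k(2)] C by (simp add: G.m_assoc)
    then show ?thesis
      using t_in [OF z] by (metis left_idealI(2) D_carrier)
  qed
  show ?thesis
    using *[OF x y] *[OF y x] t_in x y by (simp add: green_L_iff)
qed

text \<open>The multiplier s is arbitrary and must be replaced by an element of D before the Rees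
  product applies. For an idempotent e in the L-class of x with x e = x, one has x s = x (e s), and
  e s is L-related to x s, hence in D.\<close>

lemma right_mult_in_row:
  assumes x: "(i, g, l) \<in> triples M" and s: "s \<in> carrier S" "t (i, g, l) \<cdot> s \<in> D"
  obtains b k where "(i, b, k) \<in> triples M" "t (i, g, l) \<cdot> s = t (i, b, k)"
proof -
  obtain e where e: "e \<in> carrier S" "t (i, g, l) \<cdot> e = t (i, g, l)" "(e, t (i, g, l)) \<in> green_L S"
    using regularE D_regular t_in [OF x] by metis
  have "(t (i, g, l) \<cdot> s, e \<cdot> s) \<in> green_L S"
    using green_L_cong [OF e(3) s(1)] green_L_sym by blast
  then have "e \<cdot> s \<in> D"
    using s(2) D_closed_L by blast
  then obtain j h k where y: "(j, h, k) \<in> triples M" "e \<cdot> s = t (j, h, k)"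
    using t_surj by (metis mem_Sigma_iff triples_def)
  have "t (i, g, l) \<cdot> s = t (i, g, l) \<cdot> t (j, h, k)"
    using e s y t_in [OF x] by (metis assoc D_carrier)
  then show ?thesis
    using t_mult_in_D [OF x y(1)] s(2) that x y(1) by (metis mem_Sigma_iff triples_def)
qed

lemma left_mult_in_col:
  assumes x: "(i, g, l) \<in> triples M" and s: "s \<in> carrier S" "s \<cdot> t (i, g, l) \<in> D"
  obtains j b where "(j, b, l) \<in> triples M" "s \<cdot> t (i, g, l) = t (j, b, l)"
proof -
  interpret o: sgrp "opp S" by (rule sgrp_opp)
  obtain e where e: "e \<in> carrier S" "e \<cdot> t (i, g, l) = t (i, g, l)" "(e, t (i, g, l)) \<in> green_R S"
    using o.regularE [of "t (i, g, l)"] D_regular [OF t_in [OF x]] regular_opp by auto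
  have "(s \<cdot> t (i, g, l), s \<cdot> e) \<in> green_R S"
    using green_R_cong [OF e(3) s(1)] green_R_sym by blast
  then have "s \<cdot> e \<in> D"
    using s(2) D_closed_R by blast
  then obtain j h k where y: "(j, h, k) \<in> triples M" "s \<cdot> e = t (j, h, k)"
    using t_surj by (metis mem_Sigma_iff triples_def)
  have "s \<cdot> t (i, g, l) = t (j, h, k) \<cdot> t (i, g, l)"
    using e s y t_in [OF x] by (metis assoc D_carrier)
  then show ?thesis
    using t_mult_in_D [OF y(1) x] s(2) that x y(1) by (metis mem_Sigma_iff triples_def)
qed

lemma green_R_triple_iff:
  assumes x: "(i, g, l) \<in> triples M"
  shows "(t (i, g, l), y) \<in> green_R S \<longleftrightarrow> (\<exists>b\<in>carrier (grp M). \<exists>k\<in>cols M. y = t (i, b, k))"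
proof
  assume R: "(t (i, g, l), y) \<in> green_R S"
  then have "y \<in> right_ideal S (t (i, g, l))" "y \<in> D"
    using D_closed_R [OF t_in [OF x]] green_R_iff by blast+
  from this(1) show "\<exists>b\<in>carrier (grp M). \<exists>k\<in>cols M. y = t (i, b, k)"
  proof (cases rule: right_idealE)
    case 1
    then show ?thesis
      using x unfolding triples_def by blast
  next
    case (2 s)
    then obtain b k where "(i, b, k) \<in> triples M" "y = t (i, b, k)"
      using right_mult_in_row [OF x 2(1)] \<open>y \<in> D\<close> by metis
    then show ?thesis
      unfolding triples_def by blast
  qed
next
  assume "\<exists>b\<in>carrier (grp M). \<exists>k\<in>cols M. y = t (i, b, k)"
  then show "(t (i, g, l), y) \<in> green_R S"
    using x row_green_R unfolding triples_def by blast
qed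

lemma green_L_triple_iff:
  assumes x: "(i, g, l) \<in> triples M"
  shows "(t (i, g, l), y) \<in> green_L S \<longleftrightarrow> (\<exists>b\<in>carrier (grp M). \<exists>j\<in>rows M. y = t (j, b, l))"
proof
  assume L: "(t (i, g, l), y) \<in> green_L S"
  then have "y \<in> left_ideal S (t (i, g, l))" "y \<in> D"
    using D_closed_L [OF t_in [OF x]] green_L_iff by blast+
  from this(1) show "\<exists>b\<in>carrier (grp M). \<exists>j\<in>rows M. y = t (j, b, l)"
  proof (cases rule: left_idealE)
    case 1
    then show ?thesis
      using x unfolding triples_def by blast
  next
    case (2 s)
    then obtain j b where "(j, b, l) \<in> triples M" "y = t (j, b, l)"
      using left_mult_in_col [OF x 2(1)] \<open>y \<in> D\<close> by metis
    then show ?thesis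
      unfolding triples_def by blast
  qed
next
  assume "\<exists>b\<in>carrier (grp M). \<exists>j\<in>rows M. y = t (j, b, l)"
  then show "(t (i, g, l), y) \<in> green_L S"
    using x col_green_L unfolding triples_def by blast
qed

lemma D_stable_R:
  assumes "x \<in> D" "s \<in> carrier S" "x \<cdot> s \<in> D"
  shows "(x \<cdot> s, x) \<in> green_R S"
proof -
  obtain i g l where x: "(i, g, l) \<in> triples M" "x = t (i, g, l)"
    using assms t_surj by (metis mem_Sigma_iff triples_def)
  obtain b k where "(i, b, k) \<in> triples M" "x \<cdot> s = t (i, b, k)"
    using right_mult_in_row [OF x(1)] assms x(2) by metis
  then show ?thesis
    using x row_green_R by simp
qed

lemma D_stable_L:
  assumes "x \<in> D" "s \<in> carrier S" "s \<cdot> x \<in> D"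
  shows "(s \<cdot> x, x) \<in> green_L S"
proof -
  obtain i g l where x: "(i, g, l) \<in> triples M" "x = t (i, g, l)"
    using assms t_surj by (metis mem_Sigma_iff triples_def)
  obtain j b where "(j, b, l) \<in> triples M" "s \<cdot> x = t (j, b, l)"
    using left_mult_in_col [OF x(1)] assms x(2) by metis
  then show ?thesis
    using x col_green_L by simp
qed

lemma J_stable_R:
  assumes "x \<in> D" "s \<in> carrier S" "two_sided_ideal S (x \<cdot> s) = two_sided_ideal S x"
  shows "(x \<cdot> s, x) \<in> green_R S"
  using D_regular D_closed_L D_stable_R assms by (rule stable_if_stable_in_class)

lemma J_stable_L:
  assumes "x \<in> D" "s \<in> carrier S" "two_sided_ideal S (s \<cdot> x) = two_sided_ideal S x"
  shows "(s \<cdot> x, x) \<in> green_L S"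
proof -
  interpret o: sgrp "opp S" by (rule sgrp_opp)
  have "(x \<cdot>\<^bsub>opp S\<^esub> s, x) \<in> green_R (opp S)"
  proof (rule o.stable_if_stable_in_class [of D])
    show "regular (opp S) y" if "y \<in> D" for y
      using D_regular [OF that] by (simp add: regular_opp)
    show "z \<in> D" if "y \<in> D" "(y, z) \<in> green_L (opp S)" for y z
      using D_closed_R [OF that(1)] that(2) by simp
    show "(y \<cdot>\<^bsub>opp S\<^esub> v, y) \<in> green_R (opp S)"
      if "y \<in> D" "v \<in> carrier (opp S)" "y \<cdot>\<^bsub>opp S\<^esub> v \<in> D" for y v
      using D_stable_L [OF that(1)] that(2,3) by simp
  qed (use assms two_sided_ideal_opp in auto)
  then show ?thesis
    by simp
qed

end


section \<open>The free idempotent generated semigroup\<close>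

text \<open>The two properties of a biordered set on which the arguments with words rest; the
  condition that ef or fe lies in {e, f} is part of \<open>basic_pair\<close>.\<close>

locale idempotent_presentation =
  fixes E :: "'e partial_algebra"
  assumes idem: "e \<in> carrier E \<Longrightarrow> pprod E e e = Some e"
    and pprod_closed: "e \<in> carrier E \<Longrightarrow> f \<in> carrier E \<Longrightarrow> pprod E e f = Some g \<Longrightarrow> g \<in> carrier E"
begin

abbreviation "A \<equiv> carrier E"
abbreviation "K \<equiv> pres_cong (carrier E) (IG_relations E)"
abbreviation "W \<equiv> nonempty_words (carrier E)"
abbreviation IGE_mult (infixl "\<star>" 70) where "x \<star> y \<equiv> x \<cdot>\<^bsub>IG E\<^esub> y"

lemma in_W [simp]: "w \<in> W \<longleftrightarrow> w \<noteq> [] \<and> set w \<subseteq> A"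
  by (simp add: nonempty_words_def)

lemma K_words: "(u, v) \<in> K \<Longrightarrow> u \<in> W \<and> v \<in> W"
  by (induction rule: pres_cong.induct) auto

lemma bar_eqI: "(u, v) \<in> K \<Longrightarrow> bar E u = bar E v"
  unfolding bar_def by (blast intro: pres_cong.sym pres_cong.trans)

lemma bar_eqD:
  assumes "bar E u = bar E v" "u \<in> W" "v \<in> W"
  shows "(u, v) \<in> K"
proof -
  have "v \<in> bar E v"
    using assms(3) by (simp add: bar_def pres_cong.refl del: in_W)
  then show ?thesis
    using assms(1) by (simp add: bar_def set_eq_iff)
qed

lemma carrier_IG: "carrier (IG E) = bar E ` W"
  by (auto simp: IG_def presented_semigroup_def quotient_def bar_def simp del: in_W)

lemma bar_closed [simp, intro]: "w \<noteq> [] \<Longrightarrow> set w \<subseteq> A \<Longrightarrow> bar E w \<in> carrier (IG E)"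
  by (auto simp: carrier_IG)

lemma bar_append:
  assumes "u \<in> W" "v \<in> W"
  shows "bar E (u @ v) = bar E u \<star> bar E v"
proof -
  have "bar E u \<star> bar E v = (\<Union>u'\<in>bar E u. \<Union>v'\<in>bar E v. bar E (u' @ v'))"
    by (simp add: IG_def presented_semigroup_def bar_def)
  also have "\<dots> = (\<Union>u'\<in>bar E u. \<Union>v'\<in>bar E v. bar E (u @ v))"
  proof (intro SUP_cong HOL.refl)
    fix u' v' assume "u' \<in> bar E u" "v' \<in> bar E v"
    then have "(u @ v, u' @ v') \<in> K"
      unfolding bar_def by (auto intro: pres_cong.append)
    then show "bar E (u' @ v') = bar E (u @ v)"
      using bar_eqI by blast
  qed
  also have "\<dots> = bar E (u @ v)"
  proof -
    have "u \<in> bar E u" "v \<in> bar E v"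
      using assms pres_cong.refl unfolding bar_def by blast+
    then show ?thesis
      by blast
  qed
  finally show ?thesis ..
qed

sublocale sgrp "IG E"
proof
  show "is_semigroup (IG E)"
    unfolding is_semigroup_def carrier_IG ball_simps
  proof (intro conjI ballI)
    fix u v assume "u \<in> W" "v \<in> W"
    then show "bar E u \<star> bar E v \<in> bar E ` W"
      using bar_append [of u v] by (metis (full_types) Un_least append_is_Nil_conv image_eqI in_W set_append)
  next
    fix u v w assume "u \<in> W" "v \<in> W" "w \<in> W"
    then show "bar E u \<star> bar E v \<star> bar E w = bar E u \<star> (bar E v \<star> bar E w)"
      by (simp flip: bar_append)
  qed
qed

lemma wordE:
  assumes "x \<in> carrier (IG E)"
  obtains w where "w \<noteq> []" "set w \<subseteq> A" "bar E w = x"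
  using assms by (auto simp: carrier_IG)

lemma bar_Cons: "w \<noteq> [] \<Longrightarrow> set w \<subseteq> A \<Longrightarrow> e \<in> A \<Longrightarrow> bar E (e # w) = bar E [e] \<star> bar E w"
  using bar_append [of "[e]" w] by simp

lemma sprod_bar:
  assumes "ws \<noteq> []" "set ws \<subseteq> W"
  shows "sprod (IG E) (map (bar E) ws) = bar E (concat ws)"
  using assms
proof (induction ws rule: list_nonempty_induct)
  case (cons w ws)
  have W: "v \<noteq> []" "set v \<subseteq> A" if "v \<in> set ws" for v
    using cons.prems that by (auto simp: subset_iff)
  have "concat ws \<noteq> []"
    using W(1) cons.hyps by (cases ws) auto
  moreover have "set (concat ws) \<subseteq> A"
    using W(2) by fastforce
  ultimately show ?case
    using cons by (simp add: sprod_Cons bar_append)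
qed simp

lemma basic_pair_idem: "e \<in> A \<Longrightarrow> basic_pair E e e"
  by (simp add: basic_pair_def idem)

lemma bar_rel:
  assumes "basic_pair E e f" "pprod E e f = Some g" "set p \<subseteq> A" "set q \<subseteq> A"
  shows "bar E (p @ [e, f] @ q) = bar E (p @ [g] @ q)"
proof -
  have "e \<in> A" "f \<in> A"
    using assms(1) by (simp_all add: basic_pair_def)
  moreover from this have "g \<in> A"
    using assms(2) by (rule pprod_closed)
  moreover have "([e, f], [g]) \<in> IG_relations E"
    using assms(1,2) by (auto simp: IG_relations_def)
  ultimately have *: "([e, f], [g]) \<in> K"
    by (intro pres_cong.rel) simp_all
  have left: "(p @ u, p @ v) \<in> K" if "(u, v) \<in> K" for u v
    using that assms(3) pres_cong.append [OF pres_cong.refl [of p] that] by (cases "p = []") auto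
  have right: "(u @ q, v @ q) \<in> K" if "(u, v) \<in> K" for u v
    using that assms(4) pres_cong.append [OF that pres_cong.refl [of q]] by (cases "q = []") auto
  show ?thesis
    using left right * by (intro bar_eqI) blast
qed

lemma bar_rel':
  assumes "basic_pair E e f" "pprod E e f = Some g"
  shows "bar E [e] \<star> bar E [f] = bar E [g]"
proof -
  have "e \<in> A" "f \<in> A"
    using assms by (auto simp: basic_pair_def)
  then show ?thesis
    using bar_rel [OF assms, of "[]" "[]"] by (simp flip: bar_append)
qed

lemma bar_idem: "e \<in> A \<Longrightarrow> bar E [e] \<star> bar E [e] = bar E [e]"
  by (rule bar_rel' [OF basic_pair_idem idem])


subsection \<open>Seeds\<close>

text \<open>
  A word represents a regular element iff it has a seed. Along a relation \<open>e f = g\<close> the seed \<open>g\<close>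
  corresponds to the seed \<open>e\<close> or \<open>f\<close>, according to which of the two is \<open>\<R>\<close>- or \<open>\<L>\<close>-related to \<open>g\<close>.
\<close>

definition seed :: "'e list \<Rightarrow> 'e \<Rightarrow> 'e list \<Rightarrow> bool" where
  "seed u a v \<longleftrightarrow> set u \<subseteq> A \<and> a \<in> A \<and> set v \<subseteq> A \<and>
     (bar E (u @ [a]), bar E [a]) \<in> green_L (IG E) \<and> (bar E (a # v), bar E [a]) \<in> green_R (IG E)"

definition seeded :: "'e list \<Rightarrow> bool" where
  "seeded w \<longleftrightarrow> (\<exists>u a v. w = u @ a # v \<and> seed u a v)"

lemma green_R_shorten:
  assumes "(bar E (a # u @ v), bar E [a]) \<in> green_R (IG E)" "a \<in> A" "set u \<subseteq> A" "set v \<subseteq> A"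
  shows "(bar E (a # u), bar E [a]) \<in> green_R (IG E)"
proof (cases "u = [] \<or> v = []")
  case True
  then show ?thesis
    using assms green_R_refl by auto
next
  case False
  then have "bar E (a # u @ v) = bar E [a] \<star> bar E u \<star> bar E v" "bar E (a # u) = bar E [a] \<star> bar E u"
    using assms by (simp_all flip: bar_append)
  then show ?thesis
    using assms False green_R_between [of "bar E [a]" "bar E u" "bar E v"] by simp
qed

lemma green_L_shorten:
  assumes "(bar E (v @ u @ [a]), bar E [a]) \<in> green_L (IG E)" "a \<in> A" "set u \<subseteq> A" "set v \<subseteq> A"
  shows "(bar E (u @ [a]), bar E [a]) \<in> green_L (IG E)"
proof (cases "u = [] \<or> v = []")
  case True
  then show ?thesis
    using assms green_L_refl by auto
next
  case False
  then have "bar E (v @ u @ [a]) = bar E v \<star> (bar E u \<star> bar E [a])" "bar E (u @ [a]) = bar E u \<star> bar E [a]"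
    using assms by (simp_all flip: bar_append)
  then show ?thesis
    using assms False green_L_between [of "bar E v" "bar E u" "bar E [a]"] by simp
qed

lemma green_R_bar_append:
  assumes "(bar E u, bar E v) \<in> green_R (IG E)" "u \<in> W" "v \<in> W" "set p \<subseteq> A"
  shows "(bar E (p @ u), bar E (p @ v)) \<in> green_R (IG E)"
  using assms green_R_cong by (cases "p = []") (auto simp: bar_append)

lemma green_L_bar_append:
  assumes "(bar E u, bar E v) \<in> green_L (IG E)" "u \<in> W" "v \<in> W" "set p \<subseteq> A"
  shows "(bar E (u @ p), bar E (v @ p)) \<in> green_L (IG E)"
  using assms green_L_cong by (cases "p = []") (auto simp: bar_append)

context
  fixes e f g
  assumes bp: "basic_pair E e f" and ef: "pprod E e f = Some g"
begin

lemma letters: "e \<in> A" "f \<in> A" "g \<in> A"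
proof -
  show *: "e \<in> A" "f \<in> A"
    using bp by (simp_all add: basic_pair_def)
  show "g \<in> A"
    using * ef by (rule pprod_closed)
qed

lemma ef_eq: "set p \<subseteq> A \<Longrightarrow> set q \<subseteq> A \<Longrightarrow> bar E (p @ e # f # q) = bar E (p @ g # q)"
  using bar_rel [OF bp ef] by simp

lemma ef_eq': "bar E [e, f] = bar E [g]"
  using ef_eq [of "[]" "[]"] by simp

text \<open>A seed outside the subword ef survives. If e is the seed, then pe L e gives pef L ef,
  that is pg L g, while gq = efq R e and ef R e give gq R g; so g is a seed. The case of f is
  dual.\<close>

lemma seeded_contract:
  assumes "seeded (p @ e # f # q)" "set p \<subseteq> A" "set q \<subseteq> A"
  shows "seeded (p @ g # q)"
proof -
  obtain u a v where w: "p @ e # f # q = u @ a # v" and s: "seed u a v"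
    using assms by (auto simp: seeded_def)
  consider p' where "p = u @ a # p'" "v = p' @ e # f # q" | "u = p" "a = e" "v = f # q"
    | "u = p @ [e]" "a = f" "v = q" | q' where "u = p @ e # f # q'" "q = q' @ a # v"
    using w by (auto simp: append_eq_append_conv2 append_eq_Cons_conv Cons_eq_append_conv)
  then show ?thesis
  proof cases
    case 1
    then have "seed u a (p' @ g # q)"
      using s assms letters ef_eq [of "a # p'" q] by (simp add: seed_def)
    then show ?thesis
      using 1 unfolding seeded_def by auto
  next
    case 2
    have L: "(bar E (p @ [g]), bar E [g]) \<in> green_L (IG E)"
      using green_L_bar_append [of "p @ [e]" "[e]" "[f]"] s 2 letters assms
        ef_eq [of p "[]"] ef_eq [of "[]" "[]"] by (simp add: seed_def)
    have R: "(bar E (g # q), bar E [e]) \<in> green_R (IG E)"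
      using s 2 ef_eq [of "[]" q] assms by (simp add: seed_def)
    have "(bar E [e, f], bar E [e]) \<in> green_R (IG E)"
      using green_R_shorten [of e "[f]" q] s 2 letters assms by (simp add: seed_def)
    then have "(bar E (g # q), bar E [g]) \<in> green_R (IG E)"
      unfolding ef_eq' using R green_R_trans green_R_sym by blast
    then show ?thesis
      using L letters assms unfolding seeded_def seed_def by blast
  next
    case 3
    have R: "(bar E (g # q), bar E [g]) \<in> green_R (IG E)"
      using green_R_bar_append [of "f # q" "[f]" "[e]"] s 3 letters assms
        ef_eq [of "[]" q] ef_eq [of "[]" "[]"] by (simp add: seed_def)
    have L: "(bar E (p @ [g]), bar E [f]) \<in> green_L (IG E)"
      using s 3 ef_eq [of p "[]"] assms by (simp add: seed_def)
    have "(bar E [e, f], bar E [f]) \<in> green_L (IG E)"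
      using green_L_shorten [of p "[e]" f] s 3 letters assms by (simp add: seed_def)
    then have "(bar E (p @ [g]), bar E [g]) \<in> green_L (IG E)"
      unfolding ef_eq' using L green_L_trans green_L_sym by blast
    then show ?thesis
      using R letters assms unfolding seeded_def seed_def by blast
  next
    case 4
    then have "seed (p @ g # q') a v"
      using s assms letters ef_eq [of p "q' @ [a]"] by (simp add: seed_def)
    then show ?thesis
      using 4 unfolding seeded_def by (metis append.assoc append_Cons)
  qed
qed

text \<open>The delicate direction: a seed g has to be handed to e or to f. Here it is used that ef
  or fe lies in {e, f}: the seed passes to e if ef = e or fe = e, and to f if ef = f or fe =
  f.\<close>

lemma seeded_expand:
  assumes "seeded (p @ g # q)" "set p \<subseteq> A" "set q \<subseteq> A"
  shows "seeded (p @ e # f # q)"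
proof -
  obtain u a v where w: "p @ g # q = u @ a # v" and s: "seed u a v"
    using assms by (auto simp: seeded_def)
  consider p' where "p = u @ a # p'" "v = p' @ g # q" | "u = p" "a = g" "v = q"
    | q' where "u = p @ g # q'" "q = q' @ a # v"
    using w by (auto simp: append_eq_append_conv2 append_eq_Cons_conv Cons_eq_append_conv)
  then show ?thesis
  proof cases
    case 1
    then have "seed u a (p' @ e # f # q)"
      using s assms letters ef_eq [of "a # p'" q] by (simp add: seed_def)
    then show ?thesis
      using 1 unfolding seeded_def by auto
  next
    case 2
    have L: "(bar E (p @ [g]), bar E [g]) \<in> green_L (IG E)"
      and R: "(bar E (g # q), bar E [g]) \<in> green_R (IG E)"
      using s 2 by (auto simp: seed_def)
    note C = letters assms
    have eq: "bar E (e # f # q) = bar E (g # q)" "bar E (p @ [e, f]) = bar E (p @ [g])"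
      using ef_eq [of "[]" q] ef_eq [of p "[]"] assms by auto
    have ee: "bar E (r @ [e, e]) = bar E (r @ [e])" if "set r \<subseteq> A" for r
      using bar_rel [OF basic_pair_idem idem, of e r "[]"] C that by simp
    have ff: "bar E (f # f # r) = bar E (f # r)" if "set r \<subseteq> A" for r
      using bar_rel [OF basic_pair_idem idem, of f "[]" r] C that by simp
    obtain h where h: "pprod E f e = Some h" "{g, h} \<inter> {e, f} \<noteq> {}"
      using bp ef by (auto simp: basic_pair_def)
    have bp': "basic_pair E f e"
      using bp by (auto simp: basic_pair_def)
    have fe: "bar E (r @ f # e # s) = bar E (r @ h # s)" if "set r \<subseteq> A" "set s \<subseteq> A" for r s
      using bar_rel [OF bp' h(1)] that by simp
    consider "g = e" | "g = f" | "h = e" | "h = f"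
      using h(2) by auto
    then have "seed p e (f # q) \<or> seed (p @ [e]) f q"
    proof cases
      case 1
      then show ?thesis
        using L R C eq by (auto simp: seed_def)
    next
      case 2
      then show ?thesis
        using L R C eq by (auto simp: seed_def)
    next
      case 3
      \<comment> \<open>If fe = e, then g e = e f e = e e = e. With g = e f this gives g R e, and
        multiplying pg L g by e on the right gives pe L e.\<close>
      have ge: "bar E (r @ [g, e]) = bar E (r @ [e])" if "set r \<subseteq> A" for r
        using ef_eq [of r "[e]"] fe [of "r @ [e]" "[]"] ee that C 3 by simp
      have "(bar E (p @ [e]), bar E [e]) \<in> green_L (IG E)"
        using green_L_bar_append [OF L, of "[e]"] C ge [of p] ge [of "[]"] by simp
      moreover have "(bar E [g], bar E [e]) \<in> green_R (IG E)"
        unfolding green_R_iff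
        using ge [of "[]"] ef_eq [of "[]" "[]"] C right_idealI(2) [of "bar E [e]" "bar E [g]"]
          right_idealI(2) [of "bar E [f]" "bar E [e]"]
        by (simp flip: bar_append)
      ultimately show ?thesis
        using R C eq green_R_trans by (auto simp: seed_def)
    next
      case 4
      have fg: "bar E (f # g # r) = bar E (f # r)" if "set r \<subseteq> A" for r
        using ef_eq [of "[f]" r] fe [of "[]" "f # r"] ff that C 4 by simp
      have "(bar E (f # q), bar E [f]) \<in> green_R (IG E)"
        using green_R_bar_append [OF R, of "[f]"] C fg [of q] fg [of "[]"] by simp
      moreover have "(bar E [g], bar E [f]) \<in> green_L (IG E)"
        unfolding green_L_iff
        using fg [of "[]"] ef_eq [of "[]" "[]"] C left_idealI(2) [of "bar E [f]" "bar E [g]"]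
          left_idealI(2) [of "bar E [e]" "bar E [f]"]
        by (simp flip: bar_append)
      ultimately show ?thesis
        using L C eq green_L_trans by (auto simp: seed_def)
    qed
    then show ?thesis
      unfolding seeded_def by (metis append.assoc append_Cons append_Nil)
  next
    case 3
    then have "seed (p @ e # f # q') a v"
      using s assms letters ef_eq [of p "q' @ [a]"] by (simp add: seed_def)
    then show ?thesis
      using 3 unfolding seeded_def by (metis append.assoc append_Cons)
  qed
qed

end

text \<open>The contexts p and q are needed for the \<open>append\<close> case: whether a
  concatenation has a seed cannot be told from its two parts separately.\<close>

lemma seeded_cong:
  "(u, v) \<in> K \<Longrightarrow> set p \<subseteq> A \<Longrightarrow> set q \<subseteq> A \<Longrightarrow> seeded (p @ u @ q) \<longleftrightarrow> seeded (p @ v @ q)"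
proof (induction arbitrary: p q rule: pres_cong.induct)
  case (rel u v)
  then obtain e f g where uv: "u = [e, f]" "v = [g]" "basic_pair E e f" "pprod E e f = Some g"
    by (auto simp: IG_relations_def)
  then show ?case
    using seeded_contract [OF uv(3,4) _ rel.prems] seeded_expand [OF uv(3,4) _ rel.prems] by auto
next
  case (append u v u' v')
  have "set u' \<subseteq> A" "set v \<subseteq> A"
    using K_words append.hyps in_W by blast+
  then show ?case
    using append.IH(1) [of p "u' @ q"] append.IH(2) [of "p @ v" q] append.prems by simp
qed blast+

text \<open>These are the regular elements, see \<open>in_N_iff\<close>. The present form supplies
  the generator from which \<open>seeded_if_in_N\<close> starts.\<close>

definition N :: "'e list set set" where
  "N = {x. \<exists>e\<in>A. (x, bar E [e]) \<in> green_D (IG E)}"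

lemma N_closed_D: "x \<in> N \<Longrightarrow> (x, y) \<in> green_D (IG E) \<Longrightarrow> y \<in> N"
  unfolding N_def using green_D_sym green_D_trans by blast

lemma letter_in_N: "e \<in> A \<Longrightarrow> bar E [e] \<in> N"
  unfolding N_def using green_D_refl [OF bar_closed [of "[e]"]] by auto

lemma N_regular:
  assumes "x \<in> N"
  shows "regular (IG E) x"
proof -
  obtain e where e: "e \<in> A" "(x, bar E [e]) \<in> green_D (IG E)"
    using assms by (auto simp: N_def)
  have "regular (IG E) (bar E [e])"
    using e(1) bar_idem by (auto simp: regular_def intro!: bexI [of _ "bar E [e]"])
  then show ?thesis
    using regular_D e(2) green_D_sym by blast
qed

text \<open>If w R z L e for a generator e, then z = u e and w = u e v for words u, v. In the word u
  e v the letter e is a seed: with e = s z, multiplying u e v R u e by s yields e v R e. This word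
  represents the same element as w, so \<open>seeded_cong\<close> gives w a seed.\<close>

lemma seeded_if_in_N:
  assumes "bar E w \<in> N" "w \<noteq> []" "set w \<subseteq> A"
  shows "seeded w"
proof -
  obtain e z where e: "e \<in> A" "(bar E w, z) \<in> green_R (IG E)" "(z, bar E [e]) \<in> green_L (IG E)"
    using assms by (auto simp: N_def green_D_iff)
  obtain u where u: "set u \<subseteq> A" "z = bar E (u @ [e])"
  proof -
    have "z \<in> left_ideal (IG E) (bar E [e])"
      using e by (simp add: green_L_iff)
    then show ?thesis
    proof (cases rule: left_idealE)
      case 1
      then show ?thesis
        using that [of "[]"] by simp
    next
      case (2 s)
      then obtain u where "u \<noteq> []" "set u \<subseteq> A" "bar E u = s"
        using wordE by blast
      then show ?thesis
        using that [of u] 2 e bar_append [of u "[e]"] by simp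
    qed
  qed
  obtain v where v: "set v \<subseteq> A" "bar E w = bar E ((u @ [e]) @ v)"
  proof -
    have "bar E w \<in> right_ideal (IG E) z"
      using e by (simp add: green_R_iff)
    then show ?thesis
    proof (cases rule: right_idealE)
      case 1
      then show ?thesis
        using that [of "[]"] u by simp
    next
      case (2 s)
      then obtain v where "v \<noteq> []" "set v \<subseteq> A" "bar E v = s"
        using wordE by blast
      then show ?thesis
        using that [of v] 2 e u bar_append [of "u @ [e]" v] by simp
    qed
  qed
  have "(bar E (e # v), bar E [e]) \<in> green_R (IG E)"
  proof -
    have R: "(bar E ((u @ [e]) @ v), bar E (u @ [e])) \<in> green_R (IG E)"
      using e(2) u v by simp
    have "bar E [e] \<in> left_ideal (IG E) z"
      using e by (simp add: green_L_iff)
    then show ?thesis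
    proof (cases rule: left_idealE)
      case 1
      then have "bar E (e # v) = bar E ((u @ [e]) @ v)"
        using u v e(1) bar_append [of "[e]" v] bar_append [of "u @ [e]" v] by (cases "v = []") simp_all
      then show ?thesis
        using 1 u R by simp
    next
      case (2 s)
      then have "bar E (e # v) = s \<star> bar E ((u @ [e]) @ v)"
        using u v e(1) bar_append [of "[e]" v] bar_append [of "u @ [e]" v]
        by (cases "v = []") (simp_all add: assoc)
      then show ?thesis
        using 2 u green_R_cong [OF R 2(1)] by simp
    qed
  qed
  then have "seed u e v"
    using e u v by (simp add: seed_def)
  then have "seeded ((u @ [e]) @ v)"
    unfolding seeded_def by auto
  moreover have "((u @ [e]) @ v, w) \<in> K"
    using u v e assms by (intro bar_eqD) auto
  ultimately show ?thesis
    using seeded_cong [of "(u @ [e]) @ v" w "[]" "[]"] by simp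
qed

sublocale factor_set "IG E" N
proof
  show "N \<subseteq> carrier (IG E)"
    unfolding N_def using green_D_carrier by blast
  show "y \<in> N" if "x \<in> N" "(x, y) \<in> green_R (IG E)" for x y
    using that N_closed_D green_R_imp_D by blast
  show "y \<in> N" if "x \<in> N" "(x, y) \<in> green_L (IG E)" for x y
    using that N_closed_D green_L_imp_D by blast
  show "(x \<star> y, x) \<in> green_R (IG E) \<or> (x \<star> y, y) \<in> green_L (IG E)"
    if "x \<in> N" "y \<in> N" "x \<star> y \<in> N" for x y
  proof -
    have "x \<in> carrier (IG E)" "y \<in> carrier (IG E)"
      using that green_D_carrier unfolding N_def by blast+
    then obtain p q where p: "p \<noteq> []" "set p \<subseteq> A" "bar E p = x" and q: "q \<noteq> []" "set q \<subseteq> A" "bar E q = y"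
      using wordE by metis
    have xy: "x \<star> y = bar E (p @ q)"
      using p q by (simp add: bar_append)
    have "seeded (p @ q)"
      using that(3) p q by (intro seeded_if_in_N) (simp_all add: bar_append)
    then obtain u a v where w: "p @ q = u @ a # v" and s: "seed u a v"
      unfolding seeded_def by blast
    \<comment> \<open>The seed a of the joint word falls into p or into q. In p = u a r, both a r
      and a r q are R-related to a, so x R xy; in q, dually, y L xy.\<close>
    consider r where "p = u @ a # r" "v = r @ q" | r where "u = p @ r" "q = r @ a # v"
      using w by (auto simp: append_eq_append_conv2 append_eq_Cons_conv Cons_eq_append_conv)
    then show ?thesis
    proof cases
      case 1
      have "(bar E (a # r), bar E [a]) \<in> green_R (IG E)" "(bar E (a # v), bar E [a]) \<in> green_R (IG E)"
        using green_R_shorten [of a r q] s 1 by (auto simp: seed_def)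
      then have "(bar E (a # v), bar E (a # r)) \<in> green_R (IG E)"
        using green_R_trans green_R_sym by blast
      then have "(bar E (u @ a # v), bar E (u @ a # r)) \<in> green_R (IG E)"
        using s 1 q by (intro green_R_bar_append) (auto simp: seed_def)
      then show ?thesis
        using xy p 1 w by simp
    next
      case 2
      have "(bar E (r @ [a]), bar E [a]) \<in> green_L (IG E)" "(bar E (u @ [a]), bar E [a]) \<in> green_L (IG E)"
        using green_L_shorten [of p r a] s 2 by (auto simp: seed_def)
      then have "(bar E (u @ [a]), bar E (r @ [a])) \<in> green_L (IG E)"
        using green_L_trans green_L_sym by blast
      then have "(bar E ((u @ [a]) @ v), bar E ((r @ [a]) @ v)) \<in> green_L (IG E)"
        using s 2 p green_L_bar_append [of "u @ [a]" "r @ [a]" v] by (simp add: seed_def)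
      then show ?thesis
        using xy q 2 w by simp
    qed
  qed
qed

section \<open>From equal elements of IG(E) to equivalent lists of factors\<close>

abbreviation letters_of :: "'e list \<Rightarrow> 'e list set list" where
  "letters_of w \<equiv> map (\<lambda>e. bar E [e]) w"

lemma sprod_letters:
  assumes "w \<noteq> []" "set w \<subseteq> A"
  shows "sprod (IG E) (letters_of w) = bar E w"
proof -
  have "set (map (\<lambda>e. [e]) w) \<subseteq> W"
    using assms by auto
  then show ?thesis
    using sprod_bar [of "map (\<lambda>e. [e]) w"] assms by (simp add: comp_def)
qed

text \<open>The products of y with the prefixes of t lie between y and y t, so all are R-related to
  y and hence factors; the letters can be merged one by one.\<close>

lemma conn_right:
  assumes "t \<noteq> []" "set t \<subseteq> A" "y \<in> N" "(y \<star> bar E t, y) \<in> green_R (IG E)"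
  shows "conn (y # letters_of t) [y \<star> bar E t]"
  using assms(1,2,4)
proof (induction t rule: rev_nonempty_induct)
  case (single b)
  then show ?case
    using assms(3) letter_in_N N_R green_R_sym by (auto intro!: merge_conn merge_hd)
next
  case (snoc b t)
  have C: "y \<in> carrier (IG E)" "b \<in> A" "set t \<subseteq> A" "t \<noteq> []"
    using assms(3) snoc by auto
  have eq: "y \<star> bar E (t @ [b]) = y \<star> bar E t \<star> bar E [b]"
    using C by (simp add: bar_append assoc)
  have R: "(y \<star> bar E t, y) \<in> green_R (IG E)"
    using snoc.prems eq C by (intro green_R_between [of y "bar E t" "bar E [b]"]) auto
  have "y \<star> bar E t \<in> N" "y \<star> bar E (t @ [b]) \<in> N"
    using assms(3) R snoc.prems N_R green_R_sym by blast+
  then have "merge [y \<star> bar E t, bar E [b]] [y \<star> bar E (t @ [b])]"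
    using merge_hd [of "y \<star> bar E t" "bar E [b]" "[]"] C letter_in_N by (simp add: eq)
  moreover have "conn (y # letters_of t) [y \<star> bar E t]"
    using snoc R C by simp
  then have "conn (y # letters_of (t @ [b])) [y \<star> bar E t, bar E [b]]"
    using conn_append_right by fastforce
  ultimately show ?case
    using conn_trans merge_conn by blast
qed

lemma conn_left:
  assumes "set s \<subseteq> A" "a \<in> A" "(bar E (s @ [a]), bar E [a]) \<in> green_L (IG E)"
  shows "conn (letters_of (s @ [a])) [bar E (s @ [a])]"
  using assms(1,3)
proof (induction s)
  case (Cons b s)
  have L: "(bar E (s @ [a]), bar E [a]) \<in> green_L (IG E)"
    using Cons.prems assms(2) green_L_shorten [of "[b]" s a] by simp
  have "bar E (s @ [a]) \<in> N" "bar E (b # s @ [a]) \<in> N"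
    using L Cons.prems assms(2) letter_in_N N_L green_L_sym by (metis append_Cons)+
  then have "merge [bar E [b], bar E (s @ [a])] [bar E (b # s @ [a])]"
    using merge_hd [of "bar E [b]" "bar E (s @ [a])" "[]"] Cons.prems assms(2) letter_in_N
      bar_Cons [of "s @ [a]" b] by simp
  moreover have "conn (letters_of (b # s @ [a])) [bar E [b], bar E (s @ [a])]"
    using Cons L conn_Cons by simp
  ultimately show ?case
    using conn_trans merge_conn by fastforce
qed simp

text \<open>The seed first absorbs the letters on its left, nearest first, with all products in its
  L-class; the result then absorbs the letters on the right, with all products in one R-class. So
  every intermediate product is a factor.\<close>

lemma conn_word:
  assumes "w \<noteq> []" "set w \<subseteq> A" "bar E w \<in> N"
  shows "conn (letters_of w) [bar E w]"
proof -
  obtain u a v where w: "w = u @ a # v" and s: "seed u a v"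
    using seeded_if_in_N assms unfolding seeded_def by blast
  have C: "set u \<subseteq> A" "a \<in> A" "set v \<subseteq> A" and L: "(bar E (u @ [a]), bar E [a]) \<in> green_L (IG E)"
    and R: "(bar E (a # v), bar E [a]) \<in> green_R (IG E)"
    using s by (auto simp: seed_def)
  have left: "conn (letters_of (u @ [a])) [bar E (u @ [a])]"
    using C L by (intro conn_left)
  show ?thesis
  proof (cases "v = []")
    case False
    have eq: "bar E w = bar E (u @ [a]) \<star> bar E v"
      using w C False bar_append [of "u @ [a]" v] by simp
    have "(bar E (u @ a # v), bar E (u @ [a])) \<in> green_R (IG E)"
      using R C by (intro green_R_bar_append) auto
    moreover have "bar E (u @ [a]) \<in> N"
      using letter_in_N [OF C(2)] L N_L green_L_sym by blast
    ultimately have "conn (bar E (u @ [a]) # letters_of v) [bar E w]"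
      using C False w eq conn_right [of v "bar E (u @ [a])"] by simp
    moreover have "conn (letters_of w) (bar E (u @ [a]) # letters_of v)"
      using conn_append_right [OF left, of "letters_of v"] w by simp
    ultimately show ?thesis
      using conn_trans by blast
  qed (use left w in simp)
qed

text \<open>A defining relation e f = g is itself a merge of two generators.\<close>

lemma conn_cong: "(u, v) \<in> K \<Longrightarrow> conn (letters_of u) (letters_of v)"
proof (induction rule: pres_cong.induct)
  case (rel u v)
  then obtain e f g where uv: "u = [e, f]" "v = [g]" "basic_pair E e f" "pprod E e f = Some g"
    by (auto simp: IG_relations_def)
  then have "bar E [e] \<star> bar E [f] = bar E [g]"
    using bar_rel' by blast
  then show ?case
    using uv letters [OF uv(3,4)] letter_in_N merge_hd [of "bar E [e]" "bar E [f]" "[]"]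
    by (auto intro: merge_conn)
next
  case (trans u v w)
  then show ?case
    using conn_trans by blast
qed (auto intro: conn_sym conn_append)

lemma conn_letters:
  assumes "s \<noteq> []" "set s \<subseteq> N"
  shows "\<exists>w. w \<noteq> [] \<and> set w \<subseteq> A \<and> bar E w = sprod (IG E) s \<and> conn (letters_of w) s"
  using assms
proof (induction s rule: list_nonempty_induct)
  case (single x)
  then have x: "x \<in> N"
    by simp
  obtain w where "w \<noteq> []" "set w \<subseteq> A" "bar E w = x"
    using wordE [OF N_closed [OF x]] by blast
  then show ?case
    using conn_word [of w] x by (intro exI [of _ w]) simp
next
  case (cons x s)
  obtain w where w: "w \<noteq> []" "set w \<subseteq> A" "bar E w = sprod (IG E) s" "conn (letters_of w) s"
    using cons by auto
  have x: "x \<in> N"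
    using cons by simp
  obtain v where v: "v \<noteq> []" "set v \<subseteq> A" "bar E v = x"
    using wordE [OF N_closed [OF x]] by blast
  have conn_v: "conn (letters_of v) [x]"
    using conn_word [of v] v x by simp
  have "bar E (v @ w) = sprod (IG E) (x # s)"
    using v w cons by (simp add: bar_append sprod_Cons)
  moreover have "conn (letters_of (v @ w)) (x # s)"
    using conn_append [OF conn_v w(4)] by simp
  ultimately show ?case
    using v w by (intro exI [of _ "v @ w"]) simp
qed

text \<open>Both lists are refined to lists of generators. Their words represent the same element,
  so they are linked by defining relations, hence by merges.\<close>

lemma irreducible_unique:
  assumes "irreducible s" "irreducible t" "s \<noteq> []" "t \<noteq> []" "sprod (IG E) s = sprod (IG E) t"
  shows "map (two_sided_ideal (IG E)) s = map (two_sided_ideal (IG E)) t"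
proof -
  have N: "set s \<subseteq> N" "set t \<subseteq> N"
    using assms(1,2) by (simp_all add: irreducible_def)
  obtain v where v: "v \<noteq> []" "set v \<subseteq> A" "bar E v = sprod (IG E) s" "conn (letters_of v) s"
    using conn_letters [OF assms(3) N(1)] by blast
  obtain w where w: "w \<noteq> []" "set w \<subseteq> A" "bar E w = sprod (IG E) t" "conn (letters_of w) t"
    using conn_letters [OF assms(4) N(2)] by blast
  have "(v, w) \<in> K"
    using v w assms(5) by (intro bar_eqD) simp_all
  then have "conn (letters_of v) (letters_of w)"
    by (rule conn_cong)
  then have "conn s t"
    using conn_sym [OF v(4)] conn_trans w(4) by blast
  then show ?thesis
    using assms(1,2) by (rule conn_irreducible)
qed

end

section \<open>Stability in IG(E), and minimal r-factorisations as irreducible lists\<close>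

locale rees_idempotent_presentation = idempotent_presentation +
  fixes M :: "'a list set set \<Rightarrow> ('g, 'i, 'l) rees_data"
    and t :: "'a list set set \<Rightarrow> 'i \<times> 'g \<times> 'l \<Rightarrow> 'a list set"
  assumes rees: "D \<in> regular_D_classes (IG E) \<Longrightarrow> rees_identification (IG E) D (M D) (t D)"
begin

lemma rees_class: "D \<in> regular_D_classes (IG E) \<Longrightarrow> rees_class (IG E) D (M D) (t D)"
  using rees by (intro rees_class.intro sgrp_axioms rees_class_axioms.intro)

lemma ex_rees_class:
  assumes "x \<in> N"
  shows "\<exists>D. x \<in> D \<and> rees_class (IG E) D (M D) (t D)"
proof (intro exI conjI)
  show "x \<in> D_class (IG E) x"
    using green_D_refl N_closed assms by (simp add: D_class_def)
  show "rees_class (IG E) (D_class (IG E) x) (M (D_class (IG E) x)) (t (D_class (IG E) x))"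
    using N_regular [OF assms] by (intro rees_class) (auto simp: regular_D_classes_def)
qed

sublocale stable_factor_set "IG E" N
proof
  fix x assume "x \<in> carrier (IG E)"
  then obtain w where w: "w \<noteq> []" "set w \<subseteq> A" "bar E w = x"
    by (rule wordE)
  then show "\<exists>s. s \<noteq> [] \<and> set s \<subseteq> N \<and> sprod (IG E) s = x"
    using sprod_letters letter_in_N by (intro exI [of _ "letters_of w"]) auto
next
  fix s r assume "irreducible s" "irreducible r" "s \<noteq> []" "r \<noteq> []" "sprod (IG E) s = sprod (IG E) r"
  then show "mset (map (two_sided_ideal (IG E)) s) = mset (map (two_sided_ideal (IG E)) r)"
    using irreducible_unique by metis
next
  fix x v assume x: "x \<in> N"
    and *: "v \<in> carrier (IG E)" "two_sided_ideal (IG E) (x \<star> v) = two_sided_ideal (IG E) x"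
  obtain D where D: "x \<in> D" "rees_class (IG E) D (M D) (t D)"
    using ex_rees_class [OF x] by blast
  then show "(x \<star> v, x) \<in> green_R (IG E)"
    using rees_class.J_stable_R [OF D(2,1) *] by simp
next
  fix x v assume x: "x \<in> N"
    and *: "v \<in> carrier (IG E)" "two_sided_ideal (IG E) (v \<star> x) = two_sided_ideal (IG E) x"
  obtain D where D: "x \<in> D" "rees_class (IG E) D (M D) (t D)"
    using ex_rees_class [OF x] by blast
  then show "(v \<star> x, x) \<in> green_L (IG E)"
    using rees_class.J_stable_L [OF D(2,1) *] by simp
qed

lemma in_N_iff: "x \<in> N \<longleftrightarrow> regular (IG E) x"
  using N_regular regular_imp_factor by blast

lemma minimal_imp_irreducible:
  assumes "minimal_r_factorisation E p"
  shows "irreducible (map (bar E) p)" "p \<noteq> []" "sprod (IG E) (map (bar E) p) = bar E (concat p)"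
proof -
  have p: "p \<noteq> []" "\<And>w. w \<in> set p \<Longrightarrow> w \<in> W \<and> regular (IG E) (bar E w)"
    and min: "\<And>i j. i < j \<Longrightarrow> j < length p \<Longrightarrow>
      \<not> regular (IG E) (bar E (concat (map (\<lambda>k. p ! k) [i..<Suc j])))"
    using assms by (auto simp: minimal_r_factorisation_def r_factorisation_def)
  show "p \<noteq> []"
    by (rule p)
  show "sprod (IG E) (map (bar E) p) = bar E (concat p)"
    using p by (intro sprod_bar) blast+
  have "bar E (p ! i) \<star> bar E (p ! Suc i) \<notin> N" if "Suc i < length p" for i
  proof -
    have eq: "concat (map (\<lambda>k. p ! k) [i..<Suc (Suc i)]) = p ! i @ p ! Suc i"
      by (simp add: upt_rec)
    have "\<not> regular (IG E) (bar E (p ! i @ p ! Suc i))"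
      using min [of i "Suc i"] that unfolding eq by blast
    moreover have "p ! i \<in> W" "p ! Suc i \<in> W"
      using p(2) that by (meson Suc_lessD nth_mem)+
    ultimately show ?thesis
      using bar_append [of "p ! i" "p ! Suc i"] in_N_iff by simp
  qed
  then show "irreducible (map (bar E) p)"
    using p(2) in_N_iff by (auto simp: irreducible_def successively_conv_nth)
qed

end


section \<open>Green's relations in terms of triples\<close>

context rees_idempotent_presentation
begin

context
  fixes m :: nat and D :: "nat \<Rightarrow> 'a list set set" and i :: "nat \<Rightarrow> 'i" and a :: "nat \<Rightarrow> 'g"
    and l :: "nat \<Rightarrow> 'l" and x :: "'a list set"
  assumes m: "m \<ge> 1" and fingerprint: "has_fingerprint E x (map D [1..<Suc m])"
    and form: "triple_form E M t m D (\<lambda>k. (i k, a k, l k)) x"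
begin

abbreviation "\<tau> k \<equiv> t (D k) (i k, a k, l k)"

text \<open>The fingerprint makes each \<open>D k\<close> a regular D-class, so that its Rees
  identification is available. Its witness \<open>ws\<close> may differ from the words behind the
  triples.\<close>

lemma factor_rees_class:
  assumes "k \<in> {1..m}"
  shows "rees_class (IG E) (D k) (M (D k)) (t (D k))" "(i k, a k, l k) \<in> triples (M (D k))"
proof -
  obtain ws where ws: "minimal_r_factorisation E ws"
    and eq: "map (\<lambda>w. D_class (IG E) (bar E w)) ws = map D [1..<Suc m]"
    using fingerprint unfolding has_fingerprint_def by blast
  have "length ws = m"
    using arg_cong [OF eq, of length] by simp
  \<comment> \<open>Words are indexed from 0, D-classes and triples from 1.\<close>
  then have k: "k - 1 < length ws"
    using assms by auto
  then have "D_class (IG E) (bar E (ws ! (k - 1))) = map D [1..<Suc m] ! (k - 1)"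
    using eq nth_map by metis
  also have "\<dots> = D k"
    using assms by (auto simp: nth_map simp del: upt_Suc)
  finally have "D k = D_class (IG E) (bar E (ws ! (k - 1)))" ..
  moreover have "regular (IG E) (bar E (ws ! (k - 1)))"
    using ws k by (simp add: minimal_r_factorisation_def r_factorisation_def)
  ultimately have "D k \<in> regular_D_classes (IG E)"
    unfolding regular_D_classes_def by blast
  then show "rees_class (IG E) (D k) (M (D k)) (t (D k))"
    by (rule rees_class)
  show "(i k, a k, l k) \<in> triples (M (D k))"
    using form assms by (auto simp: triple_form_def)
qed

lemma factors: "irreducible (map \<tau> [1..<Suc m])" "sprod (IG E) (map \<tau> [1..<Suc m]) = x"
proof -
  obtain p where p: "length p = m" "minimal_r_factorisation E p" "bar E (concat p) = x"
    "\<And>k. k \<in> {1..m} \<Longrightarrow> bar E (p ! (k - 1)) = \<tau> k"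
    using form unfolding triple_form_def by blast
  have "map (bar E) p = map \<tau> [1..<Suc m]"
  proof (rule nth_equalityI)
    fix n assume "n < length (map (bar E) p)"
    then show "map (bar E) p ! n = map \<tau> [1..<Suc m] ! n"
      using p(1) p(4) [of "Suc n"] by (simp del: upt_Suc)
  qed (use p in simp)
  then show "irreducible (map \<tau> [1..<Suc m])" "sprod (IG E) (map \<tau> [1..<Suc m]) = x"
    using minimal_imp_irreducible [OF p(2)] p(3) by simp_all
qed

lemma factors_snoc: "map \<tau> [1..<Suc m] = map \<tau> [1..<m] @ [\<tau> m]"
  using m by simp

lemma factors_Cons: "map \<tau> [1..<Suc m] = \<tau> 1 # map \<tau> [2..<Suc m]"
  using m by (simp add: upt_conv_Cons numeral_2_eq_2 del: upt_Suc)

lemma last_factor_green_R: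
  "(\<tau> m, y) \<in> green_R (IG E) \<longleftrightarrow>
     (\<exists>b\<in>carrier (grp (M (D m))). \<exists>\<mu>\<in>cols (M (D m)). y = t (D m) (i m, b, \<mu>))"
  using m factor_rees_class [of m] by (simp add: rees_class.green_R_triple_iff)

lemma first_factor_green_L:
  "(\<tau> 1, y) \<in> green_L (IG E) \<longleftrightarrow>
     (\<exists>c\<in>carrier (grp (M (D 1))). \<exists>j\<in>rows (M (D 1)). y = t (D 1) (j, c, l 1))"
  using m factor_rees_class [of 1] by (simp add: rees_class.green_L_triple_iff)

lemma green_R_form:
  "(x, y) \<in> green_R (IG E) \<longleftrightarrow>
     (\<exists>b\<in>carrier (grp (M (D m))). \<exists>\<mu>\<in>cols (M (D m)).
        y = sprod (IG E) (map \<tau> [1..<m] @ [t (D m) (i m, b, \<mu>)]))"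
proof -
  note x = factors [unfolded factors_snoc]
  show ?thesis
    using green_R_irreducible_iff [OF x(1), of y] unfolding x(2) last_factor_green_R by blast
qed

lemma green_L_form:
  "(x, y) \<in> green_L (IG E) \<longleftrightarrow>
     (\<exists>c\<in>carrier (grp (M (D 1))). \<exists>j\<in>rows (M (D 1)).
        y = sprod (IG E) ([t (D 1) (j, c, l 1)] @ map \<tau> [2..<Suc m]))"
proof -
  note x = factors [unfolded factors_Cons]
  show ?thesis
    using green_L_irreducible_iff [OF x(1), of y] unfolding x(2) first_factor_green_L append_Cons append_Nil
    by blast
qed

text \<open>D is R followed by L. The last factor is changed in its R-class, which keeps the list
  irreducible, so the description of L applies to the new list and changes the first factor.\<close>

lemma green_D_form:
  "(x, y) \<in> green_D (IG E) \<longleftrightarrow>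
     (\<exists>b\<in>carrier (grp (M (D m))). \<exists>c\<in>carrier (grp (M (D 1))).
      \<exists>\<mu>\<in>cols (M (D m)). \<exists>j\<in>rows (M (D 1)).
        y = (if m = 1 then t (D 1) (j, b, \<mu>)
             else sprod (IG E) ([t (D 1) (j, c, l 1)] @ map \<tau> [2..<m] @ [t (D m) (i m, b, \<mu>)])))"
proof -
  note x = factors [unfolded factors_snoc]
  have "(x, y) \<in> green_D (IG E) \<longleftrightarrow> (\<exists>w. (\<tau> m, w) \<in> green_R (IG E) \<and>
      (sprod (IG E) (map \<tau> [1..<m] @ [w]), y) \<in> green_L (IG E))"
    unfolding green_D_iff green_R_irreducible_iff [OF x(1), unfolded x(2)] by blast
  also have "\<dots> \<longleftrightarrow> (\<exists>b\<in>carrier (grp (M (D m))). \<exists>\<mu>\<in>cols (M (D m)).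
      (sprod (IG E) (map \<tau> [1..<m] @ [t (D m) (i m, b, \<mu>)]), y) \<in> green_L (IG E))"
    unfolding last_factor_green_R by blast
  also have "\<dots> \<longleftrightarrow> (\<exists>b\<in>carrier (grp (M (D m))). \<exists>c\<in>carrier (grp (M (D 1))).
      \<exists>\<mu>\<in>cols (M (D m)). \<exists>j\<in>rows (M (D 1)).
        y = (if m = 1 then t (D 1) (j, b, \<mu>)
             else sprod (IG E) ([t (D 1) (j, c, l 1)] @ map \<tau> [2..<m] @ [t (D m) (i m, b, \<mu>)])))"
  proof (cases "m = 1")
    case True
    \<comment> \<open>For m = 1 both changes hit the same factor, and the second overwrites its
      group component: the c found here becomes the b of the claim.\<close>
    have "(t (D 1) (i 1, b, \<mu>), y) \<in> green_L (IG E) \<longleftrightarrow>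
        (\<exists>c\<in>carrier (grp (M (D 1))). \<exists>j\<in>rows (M (D 1)). y = t (D 1) (j, c, \<mu>))"
      if "b \<in> carrier (grp (M (D 1)))" "\<mu> \<in> cols (M (D 1))" for b \<mu>
      using that True factor_rees_class [of 1]
      by (intro rees_class.green_L_triple_iff) (simp_all add: triples_def)
    then show ?thesis
      using True by simp blast
  next
    case False
    then have "map \<tau> [1..<m] = \<tau> 1 # map \<tau> [2..<m]"
      using m by (simp add: upt_conv_Cons numeral_2_eq_2)
    moreover have "irreducible (map \<tau> [1..<m] @ [t (D m) (i m, b, \<mu>)])"
      if "b \<in> carrier (grp (M (D m)))" "\<mu> \<in> cols (M (D m))" for b \<mu>
      using irreducible_snoc_cong(1) [OF x(1)] last_factor_green_R that by blast
    ultimately have "(sprod (IG E) (map \<tau> [1..<m] @ [t (D m) (i m, b, \<mu>)]), y) \<in> green_L (IG E) \<longleftrightarrow>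
        (\<exists>c\<in>carrier (grp (M (D 1))). \<exists>j\<in>rows (M (D 1)).
          y = sprod (IG E) ([t (D 1) (j, c, l 1)] @ map \<tau> [2..<m] @ [t (D m) (i m, b, \<mu>)]))"
      if "b \<in> carrier (grp (M (D m)))" "\<mu> \<in> cols (M (D m))" for b \<mu>
      using that green_L_irreducible_iff [of "\<tau> 1" "map \<tau> [2..<m] @ [t (D m) (i m, b, \<mu>)]" y]
        first_factor_green_L by auto
    then show ?thesis
      using False by auto
  qed
  finally show ?thesis .
qed

end

end

lemma biordered_set_idempotent_presentation:
  assumes "biordered_set TYPE('s) E"
  shows "idempotent_presentation E"
proof
  show "g \<in> carrier E" if "e \<in> carrier E" "f \<in> carrier E" "pprod E e f = Some g" for e f g
    using assms that unfolding biordered_set_def by blast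
  show "pprod E e e = Some e" if e: "e \<in> carrier E" for e
  proof -
    obtain S :: "'s semigrp" and h where "h \<in> partial_algebra_iso E (idempotent_algebra S)"
      using assms unfolding biordered_set_def by blast
    then have "bij_betw h (carrier E) (carrier (idempotent_algebra S))"
      and hom: "pprod (idempotent_algebra S) (h e) (h e) = map_option h (pprod E e e)"
      using e unfolding partial_algebra_iso_def by blast+
    then have bij: "bij_betw h (carrier E) (idempotents S)"
      by (simp add: idempotent_algebra_def)
    have "h e \<cdot>\<^bsub>S\<^esub> h e = h e"
      using bij_betwE [OF bij] e by (auto simp: idempotents_def)
    then have "map_option h (pprod E e e) = Some (h e)"
      using hom by (simp add: idempotent_algebra_def)
    then obtain f where f: "pprod E e e = Some f" "h f = h e"
      by auto
    \<comment> \<open>Closure of the partial product puts f where h is injective, so that h f = h e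
      gives f = e.\<close>
    then have "f \<in> carrier E"
      using assms e unfolding biordered_set_def by blast
    then show ?thesis
      using f e bij by (auto simp: bij_betw_def inj_on_def)
  qed
qed

theorem theorem4p2:
  fixes E :: "'e partial_algebra"
    and M :: "'e list set set \<Rightarrow> ('g, 'i, 'l) rees_data"
    and t :: "'e list set set \<Rightarrow> 'i \<times> 'g \<times> 'l \<Rightarrow> 'e list set"
  assumes "finite (carrier E)"
    and "biordered_set TYPE('s) E"
    and "\<And>D. D \<in> regular_D_classes (IG E) \<Longrightarrow> rees_identification (IG E) D (M D) (t D)"
  shows
    "(\<forall>(m::nat) D i a l x y.
        m \<ge> 1 \<and> x \<in> carrier (IG E) \<and> has_fingerprint E x (map D [1..<Suc m]) \<and>
        triple_form E M t m D (\<lambda>k. (i k, a k, l k)) x \<and> y \<in> carrier (IG E) \<longrightarrow>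
        (let \<tau> = (\<lambda>k. t (D k) (i k, a k, l k));
             G = (\<lambda>k. carrier (grp (M (D k))));
             I = (\<lambda>k. rows (M (D k)));
             \<Lambda> = (\<lambda>k. cols (M (D k)))
         in
          ((x, y) \<in> green_R (IG E) \<longleftrightarrow>
             (\<exists>b\<in>G m. \<exists>\<mu>\<in>\<Lambda> m.
                y = sprod (IG E) (map \<tau> [1..<m] @ [t (D m) (i m, b, \<mu>)])))
        \<and> ((x, y) \<in> green_L (IG E) \<longleftrightarrow>
             (\<exists>c\<in>G 1. \<exists>j\<in>I 1.
                y = sprod (IG E) ([t (D 1) (j, c, l 1)] @ map \<tau> [2..<Suc m])))
        \<and> ((x, y) \<in> green_H (IG E) \<longleftrightarrow>
             (\<exists>b\<in>G m. \<exists>c\<in>G 1. \<exists>\<mu>\<in>\<Lambda> m. \<exists>j\<in>I 1.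
                y = sprod (IG E) (map \<tau> [1..<m] @ [t (D m) (i m, b, \<mu>)]) \<and>
                y = sprod (IG E) ([t (D 1) (j, c, l 1)] @ map \<tau> [2..<Suc m])))
        \<and> ((x, y) \<in> green_D (IG E) \<longleftrightarrow>
             (\<exists>b\<in>G m. \<exists>c\<in>G 1. \<exists>\<mu>\<in>\<Lambda> m. \<exists>j\<in>I 1.
                y = (if m = 1 then t (D 1) (j, b, \<mu>)
                     else sprod (IG E) ([t (D 1) (j, c, l 1)] @ map \<tau> [2..<m]
                                        @ [t (D m) (i m, b, \<mu>)]))))))
     \<and> green_D (IG E) = green_J (IG E)"
proof -
  interpret rees_idempotent_presentation E M t
    using biordered_set_idempotent_presentation [OF assms(2)] assms(3)
    by (intro rees_idempotent_presentation.intro rees_idempotent_presentation_axioms.intro)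
  show ?thesis
    unfolding Let_def
  proof (intro conjI allI impI; (elim conjE)?)
    show "green_D (IG E) = green_J (IG E)"
      by (rule green_D_eq_J)
  next
    fix m D i a l x y
    assume *: "1 \<le> (m::nat)" "has_fingerprint E x (map D [1..<Suc m])"
      "triple_form E M t m D (\<lambda>k. (i k, a k, l k)) x"
    show "(x, y) \<in> green_R (IG E) \<longleftrightarrow> (\<exists>b\<in>carrier (grp (M (D m))). \<exists>\<mu>\<in>cols (M (D m)).
        y = sprod (IG E) (map (\<lambda>k. t (D k) (i k, a k, l k)) [1..<m] @ [t (D m) (i m, b, \<mu>)]))"
      by (rule green_R_form [OF *])
    show "(x, y) \<in> green_L (IG E) \<longleftrightarrow> (\<exists>c\<in>carrier (grp (M (D 1))). \<exists>j\<in>rows (M (D 1)).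
        y = sprod (IG E) ([t (D 1) (j, c, l 1)] @ map (\<lambda>k. t (D k) (i k, a k, l k)) [2..<Suc m]))"
      by (rule green_L_form [OF *])
    show "(x, y) \<in> green_H (IG E) \<longleftrightarrow> (\<exists>b\<in>carrier (grp (M (D m))). \<exists>c\<in>carrier (grp (M (D 1))).
        \<exists>\<mu>\<in>cols (M (D m)). \<exists>j\<in>rows (M (D 1)).
        y = sprod (IG E) (map (\<lambda>k. t (D k) (i k, a k, l k)) [1..<m] @ [t (D m) (i m, b, \<mu>)]) \<and>
        y = sprod (IG E) ([t (D 1) (j, c, l 1)] @ map (\<lambda>k. t (D k) (i k, a k, l k)) [2..<Suc m]))"
      unfolding green_H_def Int_iff green_R_form [OF *] green_L_form [OF *] by blast
    show "(x, y) \<in> green_D (IG E) \<longleftrightarrow> (\<exists>b\<in>carrier (grp (M (D m))). \<exists>c\<in>carrier (grp (M (D 1))).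
        \<exists>\<mu>\<in>cols (M (D m)). \<exists>j\<in>rows (M (D 1)).
        y = (if m = 1 then t (D 1) (j, b, \<mu>)
             else sprod (IG E) ([t (D 1) (j, c, l 1)] @ map (\<lambda>k. t (D k) (i k, a k, l k)) [2..<m]
                                @ [t (D m) (i m, b, \<mu>)])))"
      by (rule green_D_form [OF *])
  qed
qed

end
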